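(* Let $P_t(k)$ be the probability that a node selected uniformly at random from $G_t$ has in-degree $k$, where $\{G_t\}_{t\ge 0}$ is generated by the mixed attachment network model with reciprocity with parameters $p$, $q$ and $A$ described in the context, with $0\le p\le 1$ and $0<\mathbb{E}[A]<\infty$. Put $m=(1+q)\mathbb{E}[A]$ and $P(k)=\lim_{t\to\infty}P_t(k)$. Then $$P(k)=\begin{cases}\dfrac{\mathbb{B}(0)}{1+\mathbb{E}[A](1-p)}, & k=0,\\[3mm] \dfrac{p(k-1)+m(1-p)}{1+q+pk+m(1-p)}P(k-1)+\dfrac{(1+q)\mathbb{B}(k)}{1+q+pk+m(1-p)}, & k>0,\end{cases}$$ and the solution of this recurrence is given by: 1. For $p=0$, $$P(k)=\frac{1}{1+\mathbb{E}[A]}\sum_{j=0}^{k}\left(\frac{\mathbb{E}[A]}{1+\mathbb{E}[A]}\right)^{k-j}\mathbb{B}(j),\quad k\ge 0.$$ 2. For $0<p<1$, $$P(k)=\frac{\Gamma\left(k+\frac{m(1-p)}{p}\right)}{\Gamma\left(k+\frac{1+q+p+m(1-p)}{p}\right)}\sum_{j=0}^{k}\frac{(1+q)\,\Gamma\left(j+\frac{1+q+p+m(1-p)}{p}\right)}{\left((1+q)(1+\mathbb{E}[A](1-p))+pj\right)\Gamma\left(j+\frac{m(1-p)}{p}\right)}\mathbb{B}(j).$$ 3. For $p=1$, $$P(k)=\begin{cases}\mathbb{B}(0), & k=0,\\[2mm] \dfrac{(1+q)\Gamma(k)}{\Gamma(k+q+2)}\displaystyle\sum_{j=1}^{k}\frac{\Gamma(j+q+2)}{(j+q+1)\Gamma(j)}\mathbb{B}(j),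 & k>0.\end{cases}$$
   Context: Model. $\{G_t\}_{t\in\{0,1,2,\ldots\}}$ is a sequence of directed networks $G_t=(V_t,E_t)$ with $n_t=|V_t|$ nodes and $e_t=|E_t|$ edges; $k_t(u)$ denotes the in-degree of node $u\in V_t$. $A$ is a random variable with values in $\{0,1,2,\ldots\}$ giving the number of new edges created by a new node, and $a_t$ denotes its $t$-th realization. The model starts from a given seed network $G_0$, which is assumed to have at least $a_1+1$ nodes. At each time $t>0$ the network evolves as follows. (M1) Growth: a new node is added to $V_{t-1}$. (M2) Mixed attachment: for a fixed $0\le p\le 1$, the new node selects and attaches to (creates edges toward) $a_t$ different nodes in $V_{t-1}$ according to the probability $$\pi_t(v\mid p)=p\,\frac{k_{t-1}(v)}{\sum_{w\in V_{t-1}}k_{t-1}(w)}+(1-p)\frac{1}{n_{t-1}}.$$ (M3) Reciprocity: each of the $a_t$ selected nodes establishes an edge to the new node with probability $0<q\le 1$ (independent Bernoulli trials). $K_t$ denotes the in-degree of a node selected uniformly at random from $G_t$, and $P_t(k)=\mathbb{P}(K_t=k)$. The limit of $P_t(k)$ exists for all $k\ge 0$ under the stated hypotheses. The number $m=(1+q)\mathbb{E}[A]$ is the expected number of new edges per time step. $\mathbb{B}(k)$ is the probability that a new node has in-degree $k$: $\mathbb{B}(k)=\sum_{i=k}^{\infty}\binom{i}{k}q^k(1-q)^{i-k}\,\mathbb{P}(A=i)$ if $0<q<1$, and $\mathbb{B}(k)=\mathbb{P}(A=k)$ if $q=1$. $\Gamma$ is the Gamma function. *)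

theory Defs
  imports
    "HOL-Probability.Probability"
    "HOL-Probability.Product_PMF"
    "Graph_Theory.Pair_Digraph"
begin

text \<open>
  A network is a \<open>nat pair_pre_digraph\<close> (finitely many nodes, no parallel edges); well-formedness
  and finiteness of the seed are the locale assumption \<open>pair_fin_digraph\<close>.
  The network at time \<open>t\<close> is represented by its law, a pmf on networks.
\<close>

definition attach_prob :: "real \<Rightarrow> nat pair_pre_digraph \<Rightarrow> nat \<Rightarrow> real" where
  "attach_prob p G v =
     p * (real (in_degree (with_proj G) v) / (\<Sum>w\<in>pverts G. real (in_degree (with_proj G) w)))
     + (1 - p) * (1 / real (card (pverts G)))"

text \<open>
  One draw from the finite nonempty set \<open>U\<close> with probabilities proportional to \<open>w\<close>. If all weights
  on \<open>U\<close> vanish, proportionality is meaningless and the draw is uniform. For \<open>w = attach_prob p G\<close>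
  this happens only for \<open>p = 1\<close>, when all nodes of \<open>U\<close> have in-degree 0.
\<close>

definition draw :: "(nat \<Rightarrow> real) \<Rightarrow> nat set \<Rightarrow> nat pmf" where
  "draw w U =
     (if 0 < (\<Sum>u\<in>U. w u)
      then embed_pmf (\<lambda>v. if v \<in> U then w v / (\<Sum>u\<in>U. w u) else 0)
      else pmf_of_set U)"

lemma pmf_draw:
  assumes "finite U" "\<And>u. u \<in> U \<Longrightarrow> 0 \<le> w u" "0 < (\<Sum>u\<in>U. w u)"
  shows "pmf (draw w U) v = (if v \<in> U then w v / (\<Sum>u\<in>U. w u) else 0)"
proof -
  let ?f = "\<lambda>v. if v \<in> U then w v / (\<Sum>u\<in>U. w u) else 0"
  have nonneg: "0 \<le> ?f v" for v
    using assms by (auto intro!: divide_nonneg_pos)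
  have "(\<integral>\<^sup>+ v. ennreal (?f v) \<partial>count_space UNIV) = (\<Sum>v\<in>U. ennreal (?f v))"
    using assms(1) by (intro nn_integral_count_space') auto
  also have "\<dots> = ennreal (\<Sum>v\<in>U. ?f v)"
    using nonneg by (intro sum_ennreal) blast
  also have "(\<Sum>v\<in>U. ?f v) = 1"
    using assms(3) by (simp add: sum_divide_distrib[symmetric])
  finally have "(\<integral>\<^sup>+ v. ennreal (?f v) \<partial>count_space UNIV) = 1"
    by simp
  then show ?thesis
    using assms(3) nonneg by (simp add: draw_def pmf_embed_pmf)
qed

text \<open>
  The set of \<open>a\<close> different nodes of \<open>V\<close> chosen one after the other without replacement, each draw
  being proportional to \<open>w\<close> on the nodes not yet chosen. If \<open>a\<close> exceeds \<open>card V\<close>, which an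
  unbounded number of new edges cannot exclude, all of \<open>V\<close> is chosen.
\<close>

primrec select :: "(nat \<Rightarrow> real) \<Rightarrow> nat set \<Rightarrow> nat \<Rightarrow> nat set pmf" where
  "select w V 0 = return_pmf {}"
| "select w V (Suc a) =
     bind_pmf (select w V a) (\<lambda>S.
       if V \<subseteq> S then return_pmf S
       else map_pmf (\<lambda>v. insert v S) (draw w (V - S)))"

definition reciprocators :: "real \<Rightarrow> nat set \<Rightarrow> nat set pmf" where
  "reciprocators q S =
     map_pmf (\<lambda>b. {v \<in> S. b v}) (Pi_pmf S False (\<lambda>_. bernoulli_pmf q))"

text \<open>
  The label \<open>Suc (Max (pverts G))\<close> is merely some label not occurring in \<open>G\<close>.
\<close>

definition add_node ::
    "nat pair_pre_digraph \<Rightarrow> nat set \<Rightarrow> nat set \<Rightarrow> nat pair_pre_digraph" where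
  "add_node G S R =
     (let x = Suc (Max (pverts G))
      in \<lparr> pverts = insert x (pverts G), parcs = parcs G \<union> {x} \<times> S \<union> R \<times> {x} \<rparr>)"

definition evolve ::
    "real \<Rightarrow> real \<Rightarrow> nat pair_pre_digraph \<Rightarrow> nat \<Rightarrow> nat pair_pre_digraph pmf" where
  "evolve p q G a =
     bind_pmf (select (attach_prob p G) (pverts G) a) (\<lambda>S.
       map_pmf (\<lambda>R. add_node G S R) (reciprocators q S))"

text \<open>
  The numbers of new edges are independent, each with law \<open>A\<close>. The seed need not have more nodes
  than the first of them, since \<open>select\<close> is defined for every \<open>a\<close>. (Requiring this almost surely
  for a fixed seed would force \<open>A\<close> to be bounded.)
\<close>

primrec network ::
    "real \<Rightarrow> real \<Rightarrow> nat pmf \<Rightarrow> nat pair_pre_digraph \<Rightarrow> nat \<Rightarrow> nat pair_pre_digraph pmf" where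
  "network p q A G\<^sub>0 0 = return_pmf G\<^sub>0"
| "network p q A G\<^sub>0 (Suc t) =
     bind_pmf (network p q A G\<^sub>0 t) (\<lambda>G. bind_pmf A (\<lambda>a. evolve p q G a))"

definition degree_pmf ::
    "real \<Rightarrow> real \<Rightarrow> nat pmf \<Rightarrow> nat pair_pre_digraph \<Rightarrow> nat \<Rightarrow> nat pmf" where
  "degree_pmf p q A G\<^sub>0 t =
     bind_pmf (network p q A G\<^sub>0 t) (\<lambda>G.
       map_pmf (in_degree (with_proj G)) (pmf_of_set (pverts G)))"

definition new_degree_prob :: "real \<Rightarrow> nat pmf \<Rightarrow> nat \<Rightarrow> real" where
  "new_degree_prob q A k =
     (if q = 1 then pmf A k
      else (\<Sum>\<^sub>\<infinity>i\<in>{k..}. real (i choose k) * q ^ k * (1 - q) ^ (i - k) * pmf A i))"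

end

(*
  Let T_j be the sum of (d(v) + 1 - j)^+ over the nodes v, where d is the in-degree; its second
  difference in j counts the nodes of in-degree j. A step increases T_j by the number of selected
  nodes with d(v) + 1 >= j plus the contribution of the new node. As these are the nodes of largest
  attachment weight, drawing without replacement selects at most as many of them, in expectation,
  as drawing with replacement would. The number of edges obeys a law of large numbers (the variance
  of an increment is bounded by 4 E[min(A, n)^2] = o(n)), so this gives a linear recursive inequality
  for E[T_j], hence limsup E[T_j] / n <= beta_j with beta_j given by a first-order recurrence.
  Since q > 0, beta_j tends to 0, so no node carries a positive fraction of all edges. Then drawing
  without replacement is asymptotically drawing with replacement, the inequality is an equality up
  to o(1), and E[T_j] / n tends to beta_j. The second difference of the recurrence for beta is the
  recurrence for P.
*)
theory Submission
  imports Defs "HOL-Real_Asymp.Real_Asymp"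
begin

text \<open>Why twice summed degree counts: the number of nodes of in-degree at least
  \<open>j\<close> grows when nodes of in-degree exactly \<open>j - 1\<close> are selected, and for
  such a middle class no one-sided comparison between drawing with and without replacement holds in
  general. It holds for the heaviest nodes, and exactly these move \<open>tail_sum\<close>. The
  obstacle is a circle: the effect of drawing without replacement is negligible if no node is
  dominant, but this is itself a statement about the limit. The circle breaks because the upper
  bound is free of such an assumption and, with the decay of the limit sequence, already excludes
  dominant nodes. The second obstacle is that \<open>A\<close> has just a first moment. Squares
  therefore occur only after truncation: by the network size in the variance, and by a level
  \<open>M\<close> in the lower bound for the selection. Index 1 is treated apart. There
  \<open>tail_sum\<close> is the total in-degree, whose increments depend on the network through its
  size alone; its concentration turns the random normalization of the preferential part into a
  deterministic one.\<close>

lemma expectation_bind_pmf: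
  fixes f :: "'b \<Rightarrow> real"
  assumes "\<And>x y. x \<in> set_pmf M \<Longrightarrow> y \<in> set_pmf (N x) \<Longrightarrow> \<bar>f y\<bar> \<le> C"
  shows "measure_pmf.expectation (bind_pmf M N) f =
         measure_pmf.expectation M (\<lambda>x. measure_pmf.expectation (N x) f)"
proof -
  \<comment> \<open>\<open>integral_bind\<close> asks for a bound everywhere, the hypothesis gives
    one on the support. Cutting \<open>f\<close> to 0 off the support changes no
    expectation.\<close>
  define g where "g y = (if y \<in> set_pmf (bind_pmf M N) then f y else 0)" for y
  have bounded: "\<bar>g y\<bar> \<le> \<bar>C\<bar>" for y
    using assms by (force simp: g_def)
  have "measure_pmf.expectation (bind_pmf M N) f = measure_pmf.expectation (bind_pmf M N) g"
    by (intro integral_cong_AE) (auto simp: g_def AE_measure_pmf_iff)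
  also have "\<dots> = measure_pmf.expectation M (\<lambda>x. measure_pmf.expectation (N x) g)"
    unfolding measure_pmf_bind using bounded measurable_measure_pmf[of N]
    by (intro integral_bind[where K = "count_space UNIV" and B = "\<bar>C\<bar>" and B' = 1])
       (auto simp: measure_pmf.emeasure_space_1 measure_pmf.finite_measure_axioms)
  also have "\<dots> = measure_pmf.expectation M (\<lambda>x. measure_pmf.expectation (N x) f)"
    by (intro integral_cong_AE) (auto simp: g_def AE_measure_pmf_iff intro!: integral_cong_AE)
  finally show ?thesis .
qed

lemma expectation_pmf_cong:
  fixes f :: "'a \<Rightarrow> real"
  assumes "\<And>x. x \<in> set_pmf M \<Longrightarrow> f x = g x"
  shows "measure_pmf.expectation M f = measure_pmf.expectation M g"
  using assms by (intro integral_cong_AE) (auto simp: AE_measure_pmf_iff)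

lemma expectation_pmf_mono:
  fixes f :: "'a \<Rightarrow> real"
  assumes "integrable (measure_pmf M) f" "integrable (measure_pmf M) g"
    and "\<And>x. x \<in> set_pmf M \<Longrightarrow> f x \<le> g x"
  shows "measure_pmf.expectation M f \<le> measure_pmf.expectation M g"
  using assms by (intro integral_mono_AE) (auto simp: AE_measure_pmf_iff)

lemma integrable_pmf_bounded:
  fixes f :: "'a \<Rightarrow> real"
  assumes "\<And>x. x \<in> set_pmf M \<Longrightarrow> \<bar>f x\<bar> \<le> C"
  shows "integrable (measure_pmf M) f"
  using assms by (intro measure_pmf.integrable_const_bound[where B = C]) (auto simp: AE_measure_pmf_iff)

section \<open>Drawing without replacement\<close>

lemma set_pmf_draw:
  assumes "finite U" "U \<noteq> {}" "\<And>u. u \<in> U \<Longrightarrow> 0 \<le> w u"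
  shows "set_pmf (draw w U) \<subseteq> U"
proof (cases "0 < (\<Sum>u\<in>U. w u)")
  case True
  then show ?thesis using pmf_draw[OF assms(1,3)] by (auto simp: set_pmf_eq)
next
  case False
  then show ?thesis using assms by (simp add: draw_def)
qed

lemma expectation_draw:
  fixes f :: "nat \<Rightarrow> real"
  assumes "finite U" "\<And>u. u \<in> U \<Longrightarrow> 0 \<le> w u" "0 < (\<Sum>u\<in>U. w u)"
  shows "measure_pmf.expectation (draw w U) f = (\<Sum>u\<in>U. f u * w u) / (\<Sum>u\<in>U. w u)"
proof -
  have "U \<noteq> {}" using assms(3) by auto
  then have "measure_pmf.expectation (draw w U) f = (\<Sum>u\<in>U. f u * pmf (draw w U) u)"
    using assms set_pmf_draw[of U w] by (intro integral_measure_pmf_real) auto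
  also have "\<dots> = (\<Sum>u\<in>U. f u * w u / (\<Sum>u\<in>U. w u))"
    by (intro sum.cong) (auto simp: pmf_draw[OF assms])
  finally show ?thesis by (simp add: sum_divide_distrib)
qed

lemma set_pmf_select:
  assumes "finite V" "\<And>v. v \<in> V \<Longrightarrow> 0 \<le> w v" "S \<in> set_pmf (select w V a)"
  shows "S \<subseteq> V \<and> card S = min a (card V)"
  using assms(3)
proof (induction a arbitrary: S)
  case 0
  then show ?case by simp
next
  case (Suc a)
  then obtain T where T: "T \<in> set_pmf (select w V a)"
    and S: "S \<in> set_pmf (if V \<subseteq> T then return_pmf T
                         else map_pmf (\<lambda>v. insert v T) (draw w (V - T)))"
    by auto
  have IH: "T \<subseteq> V" "card T = min a (card V)" using Suc.IH[OF T] by auto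
  then have finT: "finite T" using assms(1) finite_subset by auto
  show ?case
  proof (cases "V \<subseteq> T")
    case True
    then have "T = V" using IH by auto
    then show ?thesis using S IH by auto
  next
    case False
    then obtain v where v: "v \<in> set_pmf (draw w (V - T))" "S = insert v T"
      using S by auto
    then have "v \<in> V - T" using set_pmf_draw[of "V - T" w] assms(1,2) False by blast
    moreover have "card T < card V"
      using IH False assms(1) by (intro psubset_card_mono) auto
    ultimately show ?thesis using IH v finT by auto
  qed
qed

lemma finite_set_pmf_select:
  assumes "finite V" "\<And>v. v \<in> V \<Longrightarrow> 0 \<le> w v"
  shows "finite (set_pmf (select w V a))"
proof (rule finite_subset)
  show "set_pmf (select w V a) \<subseteq> Pow V" 
    using set_pmf_select[of V w _ a] assms by blast
qed (use assms in simp)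

text \<open>Conditional probability that the next draw lands in \<open>U\<close> once
  \<open>S\<close> is chosen. If no weight is left, division by zero makes it 0.\<close>

definition hit :: "(nat \<Rightarrow> real) \<Rightarrow> nat set \<Rightarrow> nat set \<Rightarrow> nat set \<Rightarrow> real" where
  "hit w V U S = (\<Sum>u\<in>U - S. w u) / (\<Sum>v\<in>V - S. w v)"

lemma hit_eq_0: "U \<subseteq> S \<Longrightarrow> hit w V U S = 0"
  unfolding hit_def Diff_eq_empty_iff[THEN iffD2] by simp

lemma expectation_select_Suc:
  fixes f :: "nat set \<Rightarrow> real"
  assumes V: "finite V" "\<And>v. v \<in> V \<Longrightarrow> 0 \<le> w v"
  shows "measure_pmf.expectation (select w V (Suc a)) f =
     measure_pmf.expectation (select w V a) (\<lambda>S. if V \<subseteq> S then f S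
       else measure_pmf.expectation (draw w (V - S)) (\<lambda>v. f (insert v S)))"
proof -
  let ?N = "\<lambda>S. if V \<subseteq> S then return_pmf S else map_pmf (\<lambda>v. insert v S) (draw w (V - S))"
  have "\<bar>f T\<bar> \<le> (\<Sum>X\<in>Pow V. \<bar>f X\<bar>)"
    if "S \<in> set_pmf (select w V a)" "T \<in> set_pmf (?N S)" for S T
  proof -
    have "T \<in> set_pmf (select w V (Suc a))"
      using that by (simp only: select.simps set_bind_pmf) blast
    then have "T \<in> Pow V" using set_pmf_select[of V w T "Suc a"] V by blast
    then show ?thesis
      using V(1) by (intro member_le_sum[of T "Pow V" "\<lambda>X. \<bar>f X\<bar>"]) auto
  qed
  then have "measure_pmf.expectation (select w V (Suc a)) f =
    measure_pmf.expectation (select w V a) (\<lambda>S. measure_pmf.expectation (?N S) f)"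
    unfolding select.simps(2) by (rule expectation_bind_pmf)
  also have "\<dots> = measure_pmf.expectation (select w V a) (\<lambda>S. if V \<subseteq> S then f S
       else measure_pmf.expectation (draw w (V - S)) (\<lambda>v. f (insert v S)))"
    by (intro arg_cong[where f = "measure_pmf.expectation _"]) auto
  finally show ?thesis .
qed

text \<open>Positivity on \<open>U\<close> makes the formula survive the uniform fallback of
  \<open>draw\<close>: if the remaining weights vanish, then \<open>U - S\<close> is empty and
  nothing is gained on either side.\<close>

lemma expectation_card_select_Suc:
  assumes V: "finite V" "\<And>v. v \<in> V \<Longrightarrow> 0 \<le> w v"
    and U: "U \<subseteq> V" "\<And>u. u \<in> U \<Longrightarrow> 0 < w u"
  shows "measure_pmf.expectation (select w V (Suc a)) (\<lambda>S. real (card (S \<inter> U))) =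
     measure_pmf.expectation (select w V a) (\<lambda>S. real (card (S \<inter> U)))
     + measure_pmf.expectation (select w V a) (hit w V U)"
proof -
  have *: "(if V \<subseteq> S then real (card (S \<inter> U))
       else measure_pmf.expectation (draw w (V - S)) (\<lambda>v. real (card (insert v S \<inter> U))))
     = real (card (S \<inter> U)) + hit w V U S" if S: "S \<in> set_pmf (select w V a)" for S
  proof (cases "V \<subseteq> S")
    case True
    then have "U \<subseteq> S" using U by auto
    then show ?thesis using True by (simp add: hit_eq_0)
  next
    case False
    have SV: "S \<subseteq> V" using set_pmf_select[OF V S] by simp
    then have fin: "finite S" using V finite_subset by auto
    have "finite U" using U(1) V(1) by (rule finite_subset)
    have supp: "set_pmf (draw w (V - S)) \<subseteq> V - S"
      using False V by (intro set_pmf_draw) auto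
    have "measure_pmf.expectation (draw w (V - S)) (\<lambda>v. real (card (insert v S \<inter> U)))
      = measure_pmf.expectation (draw w (V - S)) (\<lambda>v. real (card (S \<inter> U)) + (if v \<in> U then 1 else 0))"
      using supp fin by (intro expectation_pmf_cong) (auto simp: card_insert_if)
    also have "\<dots> = real (card (S \<inter> U))
        + measure_pmf.expectation (draw w (V - S)) (\<lambda>v. if v \<in> U then 1 else 0)"
      by (subst Bochner_Integration.integral_add)
         (auto intro!: integrable_pmf_bounded[where C = 1])
    also have "measure_pmf.expectation (draw w (V - S)) (\<lambda>v. if v \<in> U then 1 else 0) = hit w V U S"
    proof (cases "0 < (\<Sum>v\<in>V - S. w v)")
      case True
      have "(\<Sum>v\<in>V - S. (if v \<in> U then 1 else 0) * w v) = (\<Sum>u\<in>U - S. w u)"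
        using U V by (intro sum.mono_neutral_cong_right) auto
      then show ?thesis
        using V True by (subst expectation_draw) (auto simp: hit_def)
    next
      case False
      moreover have "0 \<le> (\<Sum>v\<in>V - S. w v)" using V by (intro sum_nonneg) auto
      ultimately have "(\<Sum>v\<in>V - S. w v) = 0" by simp
      then have "\<forall>v\<in>V - S. w v = 0" using V by (subst (asm) sum_nonneg_eq_0_iff) auto
      then have "v \<notin> U" if "v \<in> V - S" for v using U that by force
      moreover have "U - S \<subseteq> V - S" using U by auto
      ultimately have "U - S = {}" and "\<And>v. v \<in> V - S \<Longrightarrow> v \<notin> U" by auto
      then have "measure_pmf.expectation (draw w (V - S)) (\<lambda>v. if v \<in> U then 1 else 0 :: real)
         = measure_pmf.expectation (draw w (V - S)) (\<lambda>v. 0)"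
        using supp by (intro expectation_pmf_cong) auto
      then show ?thesis using \<open>U - S = {}\<close> by (simp add: hit_eq_0)
    qed
    finally show ?thesis using False by simp
  qed
  show ?thesis
  proof (subst expectation_select_Suc[OF V], assumption)
    show "measure_pmf.expectation (select w V a) (\<lambda>S. if V \<subseteq> S then real (card (S \<inter> U))
         else measure_pmf.expectation (draw w (V - S)) (\<lambda>v. real (card (insert v S \<inter> U)))) =
       measure_pmf.expectation (select w V a) (\<lambda>S. real (card (S \<inter> U)))
       + measure_pmf.expectation (select w V a) (hit w V U)"
      using finite_set_pmf_select[of V w a] V
      by (subst Bochner_Integration.integral_add[symmetric])
         (auto intro!: integrable_measure_pmf_finite expectation_pmf_cong simp only: *)
  qed
qed

text \<open>Divided by \<open>W\<close>, this compares the mean hit probability after one draw with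
  the one before it. With \<open>g v = w v / (W - w v)\<close> one has
  \<open>g v * W = w v + g v * w v\<close>, and multiplying by \<open>W\<close> leaves a Chebyshev
  type inequality: \<open>g\<close> increases with \<open>w\<close>, so it is larger on
  \<open>U\<close> than off \<open>U\<close>.\<close>

lemma sum_reweighted_le:
  fixes w :: "'a \<Rightarrow> real"
  assumes V: "finite V" "\<And>v. v \<in> V \<Longrightarrow> 0 \<le> w v"
    and U: "U \<subseteq> V" "\<And>u v. u \<in> U \<Longrightarrow> v \<in> V - U \<Longrightarrow> w v \<le> w u"
    and W: "W = (\<Sum>v\<in>V. w v)"
  shows "(\<Sum>v\<in>V. (\<Sum>u\<in>U - {v}. w u) / (W - w v) * w v) \<le> (\<Sum>u\<in>U. w u)"
\<comment> \<open>If one element carries all the weight, its denominator is 0 and its term vanishes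
  by convention; all other terms contain the factor 0.\<close>
proof (cases "\<exists>z\<in>V. w z = W")
  case True
  then obtain z where z: "z \<in> V" "w z = W" by auto
  then have "(\<Sum>v\<in>V - {z}. w v) = 0" using V W by (simp add: sum_diff1)
  then have "\<And>v. v \<in> V - {z} \<Longrightarrow> w v = 0"
    using V by (subst (asm) sum_nonneg_eq_0_iff) auto
  then have "(\<Sum>v\<in>V. (\<Sum>u\<in>U - {v}. w u) / (W - w v) * w v) = 0"
    using z by (intro sum.neutral) auto
  also have "0 \<le> (\<Sum>u\<in>U. w u)" using V U by (intro sum_nonneg) auto
  finally show ?thesis .
next
  case False
  have finU: "finite U" using U V finite_subset by auto
  have "w v \<le> W" if "v \<in> V" for v
    unfolding W using V that by (intro member_le_sum) auto
  then have lt: "w v < W" if "v \<in> V" for v using False that by force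
  show ?thesis
  proof (cases "V = {}")
    case True
    then show ?thesis using U by auto
  next
    case ne: False
    then obtain v0 where "v0 \<in> V" by auto
    then have Wpos: "0 < W" using lt[of v0] V(2)[of v0] by linarith
    define g where "g v = w v / (W - w v)" for v
    define u where "u = (\<Sum>x\<in>U. w x)"
    have g_mono: "g y \<le> g x" if "x \<in> U" "y \<in> V - U" for x y
    proof -
      have "w y \<le> w x" "x \<in> V" "y \<in> V" using that U by auto
      then show ?thesis unfolding g_def using lt[of x] lt[of y] V
        by (intro frac_le) auto
    qed
    have g_eq: "g v * W = w v + g v * w v" if "v \<in> V" for v
      using lt[OF that] by (simp add: g_def field_simps)
    have Wsplit: "W = u + (\<Sum>y\<in>V - U. w y)"
      unfolding W u_def using sum.subset_diff[OF U(1) V(1), of w] by simp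
    have "u * (\<Sum>y\<in>V - U. g y * w y) = (\<Sum>x\<in>U. \<Sum>y\<in>V - U. w x * (g y * w y))"
      by (simp add: u_def sum_product)
    also have "\<dots> \<le> (\<Sum>x\<in>U. \<Sum>y\<in>V - U. w x * (g x * w y))"
      using g_mono V U by (intro sum_mono mult_left_mono mult_right_mono) auto
    also have "\<dots> = (\<Sum>x\<in>U. g x * w x) * (\<Sum>y\<in>V - U. w y)"
      by (simp add: sum_distrib_left sum_distrib_right mult_ac)
    finally have cheb: "u * (\<Sum>y\<in>V - U. g y * w y) \<le> (\<Sum>x\<in>U. g x * w x) * (\<Sum>y\<in>V - U. w y)" .
    have "(\<Sum>v\<in>V. (\<Sum>x\<in>U - {v}. w x) / (W - w v) * w v)
        = (\<Sum>v\<in>V. g v * u - (if v \<in> U then g v * w v else 0))"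
    proof (intro sum.cong refl)
      fix v assume "v \<in> V"
      have "(\<Sum>x\<in>U - {v}. w x) = u - (if v \<in> U then w v else 0)"
        using finU by (auto simp: u_def sum_diff1)
      then show "(\<Sum>x\<in>U - {v}. w x) / (W - w v) * w v = g v * u - (if v \<in> U then g v * w v else 0)"
        unfolding g_def by (simp only: divide_inverse) (simp add: algebra_simps)
    qed
    also have "\<dots> = (\<Sum>v\<in>V. g v) * u - (\<Sum>v\<in>U. g v * w v)"
    proof -
      have "(\<Sum>v\<in>V. if v \<in> U then g v * w v else 0) = (\<Sum>v\<in>U. g v * w v)"
        using U V by (intro sum.mono_neutral_cong_right) auto
      then show ?thesis by (simp add: sum_subtractf sum_distrib_right)
    qed
    also have "\<dots> \<le> u"
    proof -
      have "(\<Sum>v\<in>V. g v) * W = W + (\<Sum>v\<in>V. g v * w v)"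
        using g_eq by (simp add: sum_distrib_right sum.distrib W)
      also have "(\<Sum>v\<in>V. g v * w v) = (\<Sum>v\<in>U. g v * w v) + (\<Sum>y\<in>V - U. g y * w y)"
        using sum.subset_diff[OF U(1) V(1), of "\<lambda>v. g v * w v"] by simp
      finally have gW: "(\<Sum>v\<in>V. g v) * W
         = W + ((\<Sum>v\<in>U. g v * w v) + (\<Sum>y\<in>V - U. g y * w y))" .
      have "((\<Sum>v\<in>V. g v) * u - (\<Sum>v\<in>U. g v * w v)) * W
         = u * ((\<Sum>v\<in>V. g v) * W) - (\<Sum>v\<in>U. g v * w v) * W"
        by (simp add: algebra_simps)
      also have "\<dots> = u * W + u * (\<Sum>v\<in>U. g v * w v) + u * (\<Sum>y\<in>V - U. g y * w y) - (\<Sum>v\<in>U. g v * w v) * W"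
        unfolding gW by (simp add: algebra_simps)
      also have "\<dots> \<le> u * W"
        using cheb by (subst (2) Wsplit) (simp add: algebra_simps)
      finally show ?thesis using Wpos by simp
    qed
    finally show ?thesis by (simp add: u_def)
  qed
qed

text \<open>
  The probability that the next draw hits the heaviest nodes is a supermartingale: heavy nodes are
  depleted first.
\<close>
lemma expectation_hit_Suc_le:
  assumes V: "finite V" "\<And>v. v \<in> V \<Longrightarrow> 0 \<le> w v"
    and U: "U \<subseteq> V" "\<And>u. u \<in> U \<Longrightarrow> 0 < w u"
    and heavy: "\<And>u v. u \<in> U \<Longrightarrow> v \<in> V - U \<Longrightarrow> w v \<le> w u"
  shows "measure_pmf.expectation (select w V (Suc a)) (hit w V U) \<le>
     measure_pmf.expectation (select w V a) (hit w V U)"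
proof (subst expectation_select_Suc[OF V], assumption,
    intro expectation_pmf_mono integrable_measure_pmf_finite finite_set_pmf_select V)
  fix S assume S: "S \<in> set_pmf (select w V a)"
  have SV: "S \<subseteq> V" using set_pmf_select[OF V S] by simp
  show "(if V \<subseteq> S then hit w V U S
     else measure_pmf.expectation (draw w (V - S)) (\<lambda>v. hit w V U (insert v S))) \<le> hit w V U S"
  proof (cases "V \<subseteq> S")
    case nsub: False
    let ?W = "\<Sum>v\<in>V - S. w v"
    show ?thesis
    proof (cases "0 < ?W")
      case True
      have "measure_pmf.expectation (draw w (V - S)) (\<lambda>v. hit w V U (insert v S)) =
         (\<Sum>v\<in>V - S. hit w V U (insert v S) * w v) / ?W"
        using V True by (intro expectation_draw) auto
      also have "(\<Sum>v\<in>V - S. hit w V U (insert v S) * w v) =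
         (\<Sum>v\<in>V - S. (\<Sum>u\<in>(U - S) - {v}. w u) / (?W - w v) * w v)"
      proof (intro sum.cong refl)
        fix v assume v: "v \<in> V - S"
        have "U - insert v S = U - S - {v}" "V - insert v S = V - S - {v}" by auto
        then show "hit w V U (insert v S) * w v = (\<Sum>u\<in>(U - S) - {v}. w u) / (?W - w v) * w v"
          using v V by (simp add: hit_def sum_diff1)
      qed
      also have "\<dots> \<le> (\<Sum>u\<in>U - S. w u)"
        using V U heavy by (intro sum_reweighted_le) auto
      finally show ?thesis using True nsub by (simp add: hit_def divide_right_mono)
    next
      case False
      moreover have "0 \<le> ?W" using V by (intro sum_nonneg) auto
      ultimately have "?W = 0" by simp
      then have "\<forall>v\<in>V - S. w v = 0" using V by (subst (asm) sum_nonneg_eq_0_iff) auto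
      then have "U - S = {}" using U by force
      then have "U \<subseteq> S" "\<And>v. U \<subseteq> insert v S" by auto
      then show ?thesis using nsub by (simp add: hit_eq_0)
    qed
  qed simp
qed

text \<open>By the supermartingale property, none of the \<open>a\<close> draws is likelier to hit
  \<open>U\<close> than the first one.\<close>

lemma expectation_card_select_le:
  assumes V: "finite V" "\<And>v. v \<in> V \<Longrightarrow> 0 \<le> w v"
    and U: "U \<subseteq> V" "\<And>u. u \<in> U \<Longrightarrow> 0 < w u"
    and heavy: "\<And>u v. u \<in> U \<Longrightarrow> v \<in> V - U \<Longrightarrow> w v \<le> w u"
  shows "measure_pmf.expectation (select w V a) (\<lambda>S. real (card (S \<inter> U)))
     \<le> real a * ((\<Sum>u\<in>U. w u) / (\<Sum>v\<in>V. w v))"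
proof -
  have hit: "measure_pmf.expectation (select w V a) (hit w V U) \<le> (\<Sum>u\<in>U. w u) / (\<Sum>v\<in>V. w v)" for a
  proof (induction a)
    case 0
    then show ?case by (simp add: hit_def)
  next
    case (Suc a)
    have "measure_pmf.expectation (select w V (Suc a)) (hit w V U) \<le>
      measure_pmf.expectation (select w V a) (hit w V U)"
      by (rule expectation_hit_Suc_le) (fact V U heavy)+
    then show ?case using Suc by simp
  qed
  show ?thesis
  proof (induction a)
    case (Suc a)
    then show ?case
      using hit[of a] by (subst expectation_card_select_Suc[OF V U]) (auto simp: algebra_simps add_divide_distrib)
  qed simp
qed

text \<open>After \<open>i\<close> draws at most \<open>i * \<omega>\<close> of the weight of
  \<open>U\<close> is gone, and dividing by a remaining weight of at most 1 can only enlarge the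
  quotient. The losses of all draws add up to at most
  \<open>(real a)\<^sup>2 * \<omega>\<close>.\<close>

lemma expectation_card_select_ge:
  assumes V: "finite V" "\<And>v. v \<in> V \<Longrightarrow> 0 \<le> w v"
    and U: "U \<subseteq> V" "\<And>u. u \<in> U \<Longrightarrow> 0 < w u"
    and W: "(\<Sum>v\<in>V. w v) \<le> 1" and wmax: "\<And>v. v \<in> V \<Longrightarrow> w v \<le> \<omega>" "0 \<le> \<omega>"
  shows "real a * (\<Sum>u\<in>U. w u) - (real a)\<^sup>2 * \<omega>
     \<le> measure_pmf.expectation (select w V a) (\<lambda>S. real (card (S \<inter> U)))"
proof -
  have hit: "(\<Sum>u\<in>U. w u) - real a * \<omega> \<le> measure_pmf.expectation (select w V a) (hit w V U)" for a
  proof -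
    have "(\<Sum>u\<in>U. w u) - real a * \<omega> \<le> hit w V U S" if S: "S \<in> set_pmf (select w V a)" for S
    proof -
      have SV: "S \<subseteq> V" "card S = min a (card V)" using set_pmf_select[OF V S] by auto
      have fin: "finite S" "finite U" using SV(1) U(1) V(1) by (auto intro: finite_subset)
      have "(\<Sum>v\<in>S. w v) \<le> real (card S) * \<omega>"
        using sum_bounded_above[of S w \<omega>] wmax SV by auto
      also have "\<dots> \<le> real a * \<omega>" using SV wmax by (intro mult_right_mono) auto
      finally have wS: "(\<Sum>v\<in>S. w v) \<le> real a * \<omega>" .
      have "(\<Sum>u\<in>U. w u) = (\<Sum>u\<in>U - S. w u) + (\<Sum>u\<in>U \<inter> S. w u)"
        using fin by (metis sum.Int_Diff add.commute)
      moreover have "(\<Sum>u\<in>U \<inter> S. w u) \<le> (\<Sum>u\<in>S. w u)"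
        using fin SV V by (intro sum_mono2) auto
      moreover have "(\<Sum>u\<in>U - S. w u) \<le> hit w V U S"
      proof -
        let ?x = "\<Sum>u\<in>U - S. w u" and ?W = "\<Sum>v\<in>V - S. w v"
        have x0: "0 \<le> ?x" using V U by (intro sum_nonneg) auto
        have xW: "?x \<le> ?W" using V U by (intro sum_mono2) auto
        have "?W \<le> (\<Sum>v\<in>V. w v)" using V by (intro sum_mono2) auto
        then have W1: "?W \<le> 1" using W by simp
        show ?thesis
        proof (cases "?W = 0")
          case True
          then show ?thesis using x0 xW by (simp add: hit_def)
        next
          case False
          then have "0 < ?W" using x0 xW by simp
          moreover have "?x * ?W \<le> ?x" using x0 W1 by (simp add: mult_left_le)
          ultimately show ?thesis by (simp add: hit_def pos_le_divide_eq)
        qed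
      qed
      ultimately show ?thesis using wS by linarith
    qed
    then have "measure_pmf.expectation (select w V a) (\<lambda>_. (\<Sum>u\<in>U. w u) - real a * \<omega>)
       \<le> measure_pmf.expectation (select w V a) (hit w V U)"
      by (intro expectation_pmf_mono integrable_measure_pmf_finite finite_set_pmf_select V)
    then show ?thesis by simp
  qed
  show ?thesis
  proof (induction a)
    case (Suc a)
    have "0 \<le> real a * \<omega>" using wmax by simp
    then have "real (Suc a) * (\<Sum>u\<in>U. w u) - (real (Suc a))\<^sup>2 * \<omega>
      \<le> (real a * (\<Sum>u\<in>U. w u) - (real a)\<^sup>2 * \<omega>) + ((\<Sum>u\<in>U. w u) - real a * \<omega>)"
      using wmax by (simp add: algebra_simps power2_eq_square)
    then show ?case
      using Suc hit[of a] by (subst expectation_card_select_Suc[OF V U]) auto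
  qed simp
qed

section \<open>One step of the network\<close>

abbreviation deg :: "nat pair_pre_digraph \<Rightarrow> nat \<Rightarrow> nat" where
  "deg G v \<equiv> in_degree (with_proj G) v"

text \<open>
  The subtraction is truncated: the second difference of \<open>tail_sum\<close> in \<open>j\<close> counts the nodes of
  in-degree \<open>j\<close>, and \<open>tail_sum 1\<close> is the sum of all in-degrees.
\<close>
definition tail_sum :: "nat \<Rightarrow> nat pair_pre_digraph \<Rightarrow> real" where
  "tail_sum j G = (\<Sum>v\<in>pverts G. real (Suc (deg G v) - j))"

text \<open>The nodes whose term in \<open>tail_sum j\<close> moves when their in-degree rises by
  one; they are upward closed in the in-degree, hence in the attachment probability.\<close>

definition upper :: "nat \<Rightarrow> nat pair_pre_digraph \<Rightarrow> nat set" where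
  "upper j G = {v \<in> pverts G. j \<le> Suc (deg G v)}"

lemma Suc_Max_notin: "finite V \<Longrightarrow> Suc (Max V) \<notin> (V :: nat set)"
  using Max_ge Suc_n_not_le_n by blast

lemma deg_add_node_old:
  assumes G: "pair_fin_digraph G" and v: "v \<in> pverts G" and "S \<subseteq> pverts G" "R \<subseteq> S"
  shows "deg (add_node G S R) v = deg G v + (if v \<in> S then 1 else 0)"
proof -
  interpret pair_fin_digraph G by fact
  let ?x = "Suc (Max (pverts G))"
  have x: "?x \<notin> pverts G" by (rule Suc_Max_notin) (rule pair_finite_verts)
  then have "v \<noteq> ?x" using v by auto
  have "in_arcs (with_proj (add_node G S R)) v = in_arcs (with_proj G) v \<union> (if v \<in> S then {(?x, v)} else {})"
    using \<open>v \<noteq> ?x\<close> by (auto simp: in_arcs_def add_node_def Let_def)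
  moreover have "(?x, v) \<notin> in_arcs (with_proj G) v"
    using x in_arcsD1 by (auto simp: in_arcs_def)
  moreover have "finite (in_arcs (with_proj G) v)"
    using pair_finite_arcs by (auto simp: in_arcs_def)
  ultimately show ?thesis by (simp add: in_degree_def)
qed

lemma deg_add_node_new:
  assumes G: "pair_fin_digraph G" and "S \<subseteq> pverts G" "R \<subseteq> S"
  shows "deg (add_node G S R) (Suc (Max (pverts G))) = card R"
proof -
  interpret pair_fin_digraph G by fact
  let ?x = "Suc (Max (pverts G))"
  have x: "?x \<notin> pverts G" by (rule Suc_Max_notin) (rule pair_finite_verts)
  have "in_arcs (with_proj (add_node G S R)) ?x = R \<times> {?x}"
    using x assms in_arcsD2 by (auto simp: in_arcs_def add_node_def Let_def)
  then show ?thesis by (simp add: in_degree_def card_cartesian_product)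
qed

lemma pair_fin_digraph_add_node:
  assumes G: "pair_fin_digraph G" and "S \<subseteq> pverts G" "R \<subseteq> S"
  shows "pair_fin_digraph (add_node G S R)"
proof -
  interpret pair_fin_digraph G by fact
  have "finite S" using assms(2) pair_finite_verts by (rule finite_subset)
  moreover have "finite R" using assms(3) \<open>finite S\<close> by (rule finite_subset)
  ultimately show ?thesis
    using assms(2,3) pair_finite_verts pair_finite_arcs
    by unfold_locales (auto simp: add_node_def Let_def dest: in_arcsD1 in_arcsD2)
qed

lemma card_pverts_add_node:
  assumes "pair_fin_digraph G"
  shows "card (pverts (add_node G S R)) = Suc (card (pverts G))"
  using Suc_Max_notin[of "pverts G"] pair_fin_digraph.pair_finite_verts[OF assms]
  by (simp add: add_node_def Let_def)

lemma deg_le_card_pverts: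
  assumes "pair_fin_digraph G"
  shows "deg G v \<le> card (pverts G)"
proof -
  interpret pair_fin_digraph G by fact
  have "in_arcs (with_proj G) v \<subseteq> pverts G \<times> {v}"
    using in_arcsD1 by (auto simp: in_arcs_def)
  then have "card (in_arcs (with_proj G) v) \<le> card (pverts G \<times> {v})"
    using pair_finite_verts by (intro card_mono) auto
  then show ?thesis by (simp add: in_degree_def card_cartesian_product)
qed

lemma tail_sum_nonneg: "0 \<le> tail_sum j G"
  by (simp add: tail_sum_def sum_nonneg)

lemma tail_sum_le:
  assumes "pair_fin_digraph G"
  shows "tail_sum j G \<le> real (card (pverts G)) * (1 + real (card (pverts G)))"
proof -
  have "real (Suc (deg G v) - j) \<le> 1 + real (card (pverts G))" for v
    using deg_le_card_pverts[OF assms, of v] by linarith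
  then show ?thesis unfolding tail_sum_def by (rule sum_bounded_above)
qed

lemma tail_sum_add_node:
  assumes G: "pair_fin_digraph G" and S: "S \<subseteq> pverts G" and R: "R \<subseteq> S"
  shows "tail_sum j (add_node G S R) =
    tail_sum j G + real (card (S \<inter> upper j G)) + real (Suc (card R) - j)"
proof -
  interpret pair_fin_digraph G by fact
  let ?x = "Suc (Max (pverts G))"
  have x: "?x \<notin> pverts G" by (rule Suc_Max_notin) (rule pair_finite_verts)
  have "tail_sum j (add_node G S R) = real (Suc (card R) - j)
     + (\<Sum>v\<in>pverts G. real (Suc (deg (add_node G S R) v) - j))"
  proof -
    have V: "pverts (add_node G S R) = insert ?x (pverts G)"
      by (simp add: add_node_def Let_def)
    show ?thesis unfolding tail_sum_def V
      using x pair_finite_verts by (simp add: deg_add_node_new[OF G S R])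
  qed
  also have "(\<Sum>v\<in>pverts G. real (Suc (deg (add_node G S R) v) - j))
     = (\<Sum>v\<in>pverts G. real (Suc (deg G v) - j) + (if v \<in> S \<inter> upper j G then 1 else 0))"
    by (intro sum.cong refl) (auto simp: deg_add_node_old[OF G _ S R] upper_def)
  also have "\<dots> = tail_sum j G + (\<Sum>v\<in>pverts G. if v \<in> S \<inter> upper j G then 1 else 0)"
    by (simp only: sum.distrib tail_sum_def)
  also have "(\<Sum>v\<in>pverts G. if v \<in> S \<inter> upper j G then 1 else 0 :: real) = real (card (S \<inter> upper j G))"
  proof -
    have "pverts G \<inter> {v. v \<in> S \<inter> upper j G} = S \<inter> upper j G" using S by auto
    then show ?thesis using pair_finite_verts by (simp only: sum.If_cases) simp
  qed
  finally show ?thesis by simp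
qed

lemma map_card_reciprocators:
  assumes "finite S" "0 \<le> q" "q \<le> 1"
  shows "map_pmf card (reciprocators q S) = binomial_pmf (card S) q"
  using binomial_pmf_altdef'[OF assms(1) refl, of q False] assms(2,3)
  by (simp add: reciprocators_def map_pmf_comp)

lemma set_pmf_reciprocators: "R \<in> set_pmf (reciprocators q S) \<Longrightarrow> R \<subseteq> S"
  by (auto simp: reciprocators_def)

lemma sum_deg_eq_tail_sum: "(\<Sum>v\<in>pverts G. real (deg G v)) = tail_sum 1 G"
  by (simp add: tail_sum_def)

section \<open>The attachment weight of the nodes of large in-degree\<close>

lemma card_upper:
  assumes "finite (pverts G)" "1 \<le> j"
  shows "real (card (upper j G)) = tail_sum (j - 1) G - tail_sum j G"
proof -
  have "real (card (upper j G)) = (\<Sum>v\<in>pverts G. if j \<le> Suc (deg G v) then 1 else 0)"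
    using assms by (subst sum.If_cases) (auto simp: upper_def Int_def)
  also have "\<dots> = (\<Sum>v\<in>pverts G. real (Suc (deg G v) - (j - 1)) - real (Suc (deg G v) - j))"
    using assms(2) by (intro sum.cong refl) (auto simp: Suc_diff_le)
  finally show ?thesis by (simp add: tail_sum_def sum_subtractf)
qed

text \<open>This closes the recursion. On \<open>upper j G\<close> the truncation is inactive, so an
  in-degree is its term in \<open>tail_sum j\<close> plus the constant \<open>j - 1\<close>; given
  the total in-degree and the size, the weight of \<open>upper j G\<close> is linear in two
  consecutive tail sums.\<close>

lemma sum_deg_upper:
  assumes "finite (pverts G)" "1 \<le> j"
  shows "(\<Sum>v\<in>upper j G. real (deg G v)) =
    tail_sum j G + (real j - 1) * (tail_sum (j - 1) G - tail_sum j G)"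
proof -
  have "(\<Sum>v\<in>upper j G. real (deg G v)) = (\<Sum>v\<in>upper j G. real (Suc (deg G v) - j) + (real j - 1))"
    by (intro sum.cong refl) (auto simp: upper_def)
  also have "\<dots> = (\<Sum>v\<in>upper j G. real (Suc (deg G v) - j)) + (real j - 1) * real (card (upper j G))"
    by (simp add: sum.distrib)
  also have "(\<Sum>v\<in>upper j G. real (Suc (deg G v) - j)) = tail_sum j G"
    unfolding tail_sum_def using assms by (intro sum.mono_neutral_left) (auto simp: upper_def)
  finally show ?thesis by (simp add: card_upper[OF assms])
qed

lemma attach_prob_nonneg: "0 \<le> p \<Longrightarrow> p \<le> 1 \<Longrightarrow> 0 \<le> attach_prob p G v"
  by (simp add: attach_prob_def sum_nonneg)

lemma sum_attach_prob:
  "(\<Sum>v\<in>U. attach_prob p G v) = p * ((\<Sum>v\<in>U. real (deg G v)) / tail_sum 1 G)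
     + (1 - p) * (real (card U) / real (card (pverts G)))"
  unfolding attach_prob_def sum_deg_eq_tail_sum
  by (simp add: sum.distrib sum_distrib_left sum_divide_distrib)

text \<open>Only an inequality: in a nonempty network without edges the preferential part is 0 / 0 =
  0, and the sum is \<open>1 - p\<close>.\<close>

lemma sum_attach_prob_le_1:
  assumes "0 \<le> p" "p \<le> 1"
  shows "(\<Sum>v\<in>pverts G. attach_prob p G v) \<le> 1"
proof -
  have "tail_sum 1 G / tail_sum 1 G \<le> 1"
    "real (card (pverts G)) / real (card (pverts G)) \<le> 1"
    by (simp_all add: divide_self_if)
  then have "p * (tail_sum 1 G / tail_sum 1 G)
     + (1 - p) * (real (card (pverts G)) / real (card (pverts G))) \<le> p * 1 + (1 - p) * 1"
    using assms by (intro add_mono mult_left_mono) auto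
  then show ?thesis unfolding sum_attach_prob sum_deg_eq_tail_sum by simp
qed

text \<open>For \<open>j\<close> at least 2 the nodes of \<open>upper j G\<close> have an incoming
  edge, so their weight is positive even for \<open>p = 1\<close>, where nodes of in-degree 0 have
  weight 0.\<close>

lemma attach_prob_upper_pos:
  assumes "finite (pverts G)" "0 \<le> p" "p \<le> 1" "2 \<le> j" "u \<in> upper j G"
  shows "0 < attach_prob p G u" "0 < tail_sum 1 G"
proof -
  have u: "u \<in> pverts G" "0 < deg G u" using assms(4,5) by (auto simp: upper_def)
  have "real (deg G u) \<le> tail_sum 1 G"
    unfolding sum_deg_eq_tail_sum[symmetric] using u assms(1) by (intro member_le_sum) auto
  then show D: "0 < tail_sum 1 G" using u by linarith
  have n: "0 < real (card (pverts G))" using u assms(1) by (auto simp: card_gt_0_iff)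
  have "0 < p * (real (deg G u) / tail_sum 1 G) + (1 - p) * (1 / real (card (pverts G)))"
  proof (cases "p = 0")
    case False
    then show ?thesis using assms u D n by (intro add_pos_nonneg) auto
  qed (use n in simp)
  then show "0 < attach_prob p G u" by (simp add: attach_prob_def sum_deg_eq_tail_sum)
qed

lemma attach_prob_mono:
  assumes "0 \<le> p" "deg G v \<le> deg G u"
  shows "attach_prob p G v \<le> attach_prob p G u"
  unfolding attach_prob_def using assms
  by (intro add_right_mono mult_left_mono divide_right_mono) (auto simp: sum_nonneg)

lemma expectation_card_select_upper_le:
  assumes G: "finite (pverts G)" and p: "0 \<le> p" "p \<le> 1" and j: "2 \<le> j"
  shows "measure_pmf.expectation (select (attach_prob p G) (pverts G) a)
       (\<lambda>S. real (card (S \<inter> upper j G)))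
     \<le> real a * (\<Sum>u\<in>upper j G. attach_prob p G u)"
proof (cases "upper j G = {}")
  case False
  then obtain u where u: "u \<in> upper j G" by auto
  then have "card (pverts G) \<noteq> 0" using G by (auto simp: upper_def)
  \<comment> \<open>Some in-degree is positive here, so no quotient is 0 / 0 and the weights sum to
    exactly 1.\<close>
  then have W: "(\<Sum>v\<in>pverts G. attach_prob p G v) = 1"
    unfolding sum_attach_prob sum_deg_eq_tail_sum
    using attach_prob_upper_pos(2)[OF G p j u] by simp
  have "measure_pmf.expectation (select (attach_prob p G) (pverts G) a)
       (\<lambda>S. real (card (S \<inter> upper j G)))
     \<le> real a * ((\<Sum>u\<in>upper j G. attach_prob p G u) / (\<Sum>v\<in>pverts G. attach_prob p G v))"
  proof (rule expectation_card_select_le[OF G])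
    show "0 \<le> attach_prob p G v" for v using p by (rule attach_prob_nonneg)
    show "upper j G \<subseteq> pverts G" by (auto simp: upper_def)
    show "0 < attach_prob p G u" if "u \<in> upper j G" for u
      using attach_prob_upper_pos(1)[OF G p j that] .
    show "attach_prob p G v \<le> attach_prob p G u" if "u \<in> upper j G" "v \<in> pverts G - upper j G" for u v
      using that p by (intro attach_prob_mono) (auto simp: upper_def)
  qed
  then show ?thesis using W by simp
qed simp

text \<open>The loss is also at most \<open>a\<close>, since the weights sum to at most 1. This
  bound is integrable over \<open>A\<close>, whereas the quadratic one may fail to be.\<close>

lemma expectation_card_select_upper_ge:
  assumes G: "finite (pverts G)" and p: "0 \<le> p" "p \<le> 1" and j: "2 \<le> j"
    and \<omega>: "\<And>v. v \<in> pverts G \<Longrightarrow> attach_prob p G v \<le> \<omega>" "0 \<le> \<omega>"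
  shows "real a * (\<Sum>u\<in>upper j G. attach_prob p G u) - min (real a) ((real a)\<^sup>2 * \<omega>)
     \<le> measure_pmf.expectation (select (attach_prob p G) (pverts G) a)
       (\<lambda>S. real (card (S \<inter> upper j G)))"
proof -
  let ?E = "measure_pmf.expectation (select (attach_prob p G) (pverts G) a)
       (\<lambda>S. real (card (S \<inter> upper j G)))"
  have "real a * (\<Sum>u\<in>upper j G. attach_prob p G u) - (real a)\<^sup>2 * \<omega> \<le> ?E"
  proof (rule expectation_card_select_ge[OF G])
    show "0 \<le> attach_prob p G v" for v using p by (rule attach_prob_nonneg)
    show "upper j G \<subseteq> pverts G" by (auto simp: upper_def)
    show "0 < attach_prob p G u" if "u \<in> upper j G" for u
      using attach_prob_upper_pos(1)[OF G p j that] .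
  qed (use \<omega> sum_attach_prob_le_1[OF p] in auto)
  moreover have "real a * (\<Sum>u\<in>upper j G. attach_prob p G u) - real a \<le> ?E"
  proof -
    have "(\<Sum>u\<in>upper j G. attach_prob p G u) \<le> (\<Sum>v\<in>pverts G. attach_prob p G v)"
      using G attach_prob_nonneg[OF p] by (intro sum_mono2) (auto simp: upper_def)
    also have "\<dots> \<le> 1" by (rule sum_attach_prob_le_1[OF p])
    finally have "real a * (\<Sum>u\<in>upper j G. attach_prob p G u) \<le> real a" by (simp add: mult_left_le)
    moreover have "0 \<le> ?E" by simp
    ultimately show ?thesis by linarith
  qed
  ultimately show ?thesis by (simp add: min_def)
qed

lemma evolve_support:
  assumes G: "pair_fin_digraph G" and p: "0 \<le> p" "p \<le> 1"
    and H: "H \<in> set_pmf (evolve p q G a)"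
  obtains S R where "S \<in> set_pmf (select (attach_prob p G) (pverts G) a)" "S \<subseteq> pverts G"
    "card S = min a (card (pverts G))" "R \<subseteq> S" "H = add_node G S R"
proof -
  obtain S R where S: "S \<in> set_pmf (select (attach_prob p G) (pverts G) a)"
    and R: "R \<in> set_pmf (reciprocators q S)" and "H = add_node G S R"
    using H by (auto simp: evolve_def)
  moreover have "S \<subseteq> pverts G \<and> card S = min a (card (pverts G))"
    by (rule set_pmf_select[OF pair_fin_digraph.pair_finite_verts[OF G] _ S])
       (rule attach_prob_nonneg[OF p])
  ultimately show ?thesis using that set_pmf_reciprocators[OF R] by blast
qed

text \<open>The law of \<open>card R\<close> depends on the selected set only through its size,
  which is always \<open>min a (card (pverts G))\<close>; so the contribution of the new node
  separates from the selection.\<close>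

lemma expectation_tail_sum_evolve:
  assumes G: "pair_fin_digraph G" and p: "0 \<le> p" "p \<le> 1" and q: "0 \<le> q" "q \<le> 1"
  shows "measure_pmf.expectation (evolve p q G a) (tail_sum j) = tail_sum j G
     + measure_pmf.expectation (select (attach_prob p G) (pverts G) a)
         (\<lambda>S. real (card (S \<inter> upper j G)))
     + measure_pmf.expectation (binomial_pmf (min a (card (pverts G))) q) (\<lambda>r. real (Suc r - j))"
proof -
  let ?n = "card (pverts G)" and ?sel = "select (attach_prob p G) (pverts G) a"
  have finV: "finite (pverts G)" using G by (rule pair_fin_digraph.pair_finite_verts)
  have sel: "S \<subseteq> pverts G" "card S = min a ?n" "finite S" if "S \<in> set_pmf ?sel" for S
  proof -
    show "S \<subseteq> pverts G" "card S = min a ?n"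
      using set_pmf_select[OF finV _ that] attach_prob_nonneg[OF p] by blast+
    then show "finite S" using finV by (blast intro: finite_subset)
  qed
  have "measure_pmf.expectation (evolve p q G a) (tail_sum j) =
    measure_pmf.expectation ?sel (\<lambda>S. measure_pmf.expectation
      (map_pmf (\<lambda>R. add_node G S R) (reciprocators q S)) (tail_sum j))"
    unfolding evolve_def
  proof (rule expectation_bind_pmf)
    fix S H assume S: "S \<in> set_pmf ?sel"
      and "H \<in> set_pmf (map_pmf (add_node G S) (reciprocators q S))"
    then obtain R where R: "R \<in> set_pmf (reciprocators q S)" and "H = add_node G S R"
      unfolding set_map_pmf by blast
    moreover have "R \<subseteq> S" using R by (rule set_pmf_reciprocators)
    ultimately have "pair_fin_digraph H" "card (pverts H) = Suc ?n"
      using pair_fin_digraph_add_node[OF G sel(1)[OF S]] card_pverts_add_node[OF G] by blast+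
    then show "\<bar>tail_sum j H\<bar> \<le> real (Suc ?n) * (1 + real (Suc ?n))"
      using tail_sum_le[of H j] tail_sum_nonneg[of j H] by simp
  qed
  also have "\<dots> = measure_pmf.expectation ?sel (\<lambda>S. tail_sum j G + real (card (S \<inter> upper j G))
     + measure_pmf.expectation (binomial_pmf (min a ?n) q) (\<lambda>r. real (Suc r - j)))"
  proof (rule expectation_pmf_cong)
    fix S assume S: "S \<in> set_pmf ?sel"
    have "set_pmf (reciprocators q S) \<subseteq> Pow S" using set_pmf_reciprocators by blast
    then have fin: "finite (set_pmf (reciprocators q S))"
      by (rule finite_subset) (use sel(3)[OF S] in simp)
    have "measure_pmf.expectation (map_pmf (add_node G S) (reciprocators q S)) (tail_sum j) =
      measure_pmf.expectation (reciprocators q S)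
        (\<lambda>R. tail_sum j G + real (card (S \<inter> upper j G)) + real (Suc (card R) - j))"
      unfolding integral_map_pmf
      by (rule expectation_pmf_cong)
         (use tail_sum_add_node[OF G sel(1)[OF S]] set_pmf_reciprocators in auto)
    also have "\<dots> = tail_sum j G + real (card (S \<inter> upper j G))
        + measure_pmf.expectation (reciprocators q S) (\<lambda>R. real (Suc (card R) - j))"
      using fin by (subst Bochner_Integration.integral_add)
        (auto intro: integrable_measure_pmf_finite)
    also have "measure_pmf.expectation (reciprocators q S) (\<lambda>R. real (Suc (card R) - j)) =
       measure_pmf.expectation (map_pmf card (reciprocators q S)) (\<lambda>r. real (Suc r - j))"
      by simp
    also have "map_pmf card (reciprocators q S) = binomial_pmf (min a ?n) q"
      using map_card_reciprocators[OF sel(3)[OF S] q] sel(2)[OF S] by simp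
    finally show "measure_pmf.expectation (map_pmf (add_node G S) (reciprocators q S)) (tail_sum j) =
      tail_sum j G + real (card (S \<inter> upper j G))
       + measure_pmf.expectation (binomial_pmf (min a ?n) q) (\<lambda>r. real (Suc r - j))" .
  qed
  also have "\<dots> = tail_sum j G + measure_pmf.expectation ?sel (\<lambda>S. real (card (S \<inter> upper j G)))
     + measure_pmf.expectation (binomial_pmf (min a ?n) q) (\<lambda>r. real (Suc r - j))"
    using finite_set_pmf_select[OF finV, of "attach_prob p G" a] attach_prob_nonneg[OF p, of G]
    by (subst Bochner_Integration.integral_add, auto intro: integrable_measure_pmf_finite)+
  finally show ?thesis .
qed

text \<open>All nodes lie in \<open>upper 1 G\<close>, so it does not matter which ones are selected
  and the increment depends on \<open>G\<close> through its size alone. The whole law is recorded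
  because second moments are taken later.\<close>

lemma map_total_degree_evolve:
  assumes G: "pair_fin_digraph G" and p: "0 \<le> p" "p \<le> 1" and q: "0 \<le> q" "q \<le> 1"
  shows "map_pmf (tail_sum 1) (evolve p q G a) =
     map_pmf (\<lambda>r. tail_sum 1 G + real (min a (card (pverts G))) + real r)
       (binomial_pmf (min a (card (pverts G))) q)"
proof -
  let ?n = "card (pverts G)" and ?sel = "select (attach_prob p G) (pverts G) a"
  have finV: "finite (pverts G)" using G by (rule pair_fin_digraph.pair_finite_verts)
  have "map_pmf (tail_sum 1) (evolve p q G a) = bind_pmf ?sel (\<lambda>S.
    map_pmf (\<lambda>R. tail_sum 1 (add_node G S R)) (reciprocators q S))"
    by (simp add: evolve_def map_bind_pmf map_pmf_comp)
  also have "\<dots> = bind_pmf ?sel (\<lambda>S. map_pmf (\<lambda>r. tail_sum 1 G + real (min a ?n) + real r)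
       (binomial_pmf (min a ?n) q))"
  proof (rule bind_pmf_cong[OF refl])
    fix S assume sel: "S \<in> set_pmf ?sel"
    have S: "S \<subseteq> pverts G" "card S = min a ?n"
      using set_pmf_select[OF finV _ sel] attach_prob_nonneg[OF p] by blast+
    then have "finite S" using finV by (blast intro: finite_subset)
    have "map_pmf (\<lambda>R. tail_sum 1 (add_node G S R)) (reciprocators q S) =
      map_pmf (\<lambda>R. tail_sum 1 G + real (min a ?n) + real (card R)) (reciprocators q S)"
    proof (rule map_pmf_cong[OF refl])
      fix R assume "R \<in> set_pmf (reciprocators q S)"
      then have "R \<subseteq> S" by (rule set_pmf_reciprocators)
      moreover have "S \<inter> upper 1 G = S" using S by (auto simp: upper_def)
      ultimately show "tail_sum 1 (add_node G S R) = tail_sum 1 G + real (min a ?n) + real (card R)"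
        using S by (simp add: tail_sum_add_node[OF G])
    qed
    also have "\<dots> = map_pmf (\<lambda>r. tail_sum 1 G + real (min a ?n) + real r)
        (map_pmf card (reciprocators q S))"
      by (simp add: map_pmf_comp)
    finally show "map_pmf (\<lambda>R. tail_sum 1 (add_node G S R)) (reciprocators q S) =
      map_pmf (\<lambda>r. tail_sum 1 G + real (min a ?n) + real r) (binomial_pmf (min a ?n) q)"
      using map_card_reciprocators[OF \<open>finite S\<close> q] S by simp
  qed
  finally show ?thesis by simp
qed

section \<open>Recursive inequalities\<close>

text \<open>The line \<open>u * real (n + t)\<close> solves the recursion with constant source
  \<open>u * (1 + \<gamma>)\<close>. The excess of \<open>x\<close> over a line of slightly larger
  slope than the limit is multiplied by \<open>1 - \<gamma> / real (n + t)\<close> in each step,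
  hence stays bounded, and disappears in the average.\<close>

lemma average_le_of_recursion:
  fixes x g :: "nat \<Rightarrow> real" and n :: nat
  assumes \<gamma>: "0 \<le> \<gamma>"
    and rec: "\<And>t. x (Suc t) \<le> x t - \<gamma> * x t / real (n + t) + g t"
    and g: "\<And>\<epsilon>. 0 < \<epsilon> \<Longrightarrow> eventually (\<lambda>t. g t \<le> l + \<epsilon>) sequentially"
    and \<epsilon>: "0 < \<epsilon>"
  shows "eventually (\<lambda>t. x t / real (n + t) \<le> l / (1 + \<gamma>) + \<epsilon>) sequentially"
proof -
  \<comment> \<open>Half of \<epsilon> goes into the slope and dominates \<open>g\<close>; the other
    half absorbs the bounded excess.\<close>
  define u where "u = l / (1 + \<gamma>) + \<epsilon> / 2"
  have u: "u * (1 + \<gamma>) = l + \<epsilon> / 2 * (1 + \<gamma>)"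
    using \<gamma> by (simp add: u_def field_simps)
  have "0 < \<epsilon> / 2 * (1 + \<gamma>)" using \<gamma> \<epsilon> by simp
  from g[OF this] have "eventually (\<lambda>t. g t \<le> u * (1 + \<gamma>)) sequentially" by (simp add: u)
  moreover have "eventually (\<lambda>t. \<gamma> \<le> real (n + t)) sequentially" by real_asymp
  moreover have "eventually (\<lambda>t. 0 < real (n + t)) sequentially" by real_asymp
  ultimately have "eventually (\<lambda>t. g t \<le> u * (1 + \<gamma>) \<and> \<gamma> \<le> real (n + t) \<and> 0 < real (n + t)) sequentially"
    by eventually_elim simp
  then obtain t0 where t0: "\<And>t. t0 \<le> t \<Longrightarrow> g t \<le> u * (1 + \<gamma>)"
      "\<And>t. t0 \<le> t \<Longrightarrow> \<gamma> \<le> real (n + t)" "\<And>t. t0 \<le> t \<Longrightarrow> 0 < real (n + t)"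
    by (auto simp: eventually_sequentially)
  \<comment> \<open>Nonnegative, so that multiplying by a factor in [0, 1] keeps the bound.\<close>
  define C where "C = max 0 (x t0 - u * real (n + t0))"
  have bound: "x t - u * real (n + t) \<le> C" if "t0 \<le> t" for t
    using that
  proof (induction t rule: dec_induct)
    case base
    then show ?case by (simp add: C_def)
  next
    case (step t)
    let ?N = "real (n + t)"
    have N: "0 < ?N" "\<gamma> \<le> ?N" using t0 step by auto
    have "x (Suc t) - u * real (n + Suc t) \<le> x t - \<gamma> * x t / ?N + u * (1 + \<gamma>) - u * (?N + 1)"
      using rec[of t] t0(1)[of t] step by (simp add: algebra_simps)
    also have "\<dots> = (1 - \<gamma> / ?N) * (x t - u * ?N)"
      using N by (simp add: field_simps)
    also have "\<dots> \<le> (1 - \<gamma> / ?N) * C"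
      using step N by (intro mult_left_mono) auto
    also have "\<dots> \<le> C"
      using N \<gamma> by (intro mult_left_le_one_le) (auto simp: C_def)
    finally show ?case .
  qed
  have "eventually (\<lambda>t. C \<le> \<epsilon> / 2 * real (n + t)) sequentially"
    using \<epsilon> by real_asymp
  moreover have "eventually (\<lambda>t. t0 \<le> t) sequentially" by (rule eventually_ge_at_top)
  ultimately show ?thesis
  proof eventually_elim
    case (elim t)
    have "x t \<le> (u + \<epsilon> / 2) * real (n + t)"
      using bound[OF elim(2)] elim(1) distrib_right[of u "\<epsilon> / 2" "real (n + t)"] by linarith
    moreover have "u + \<epsilon> / 2 = l / (1 + \<gamma>) + \<epsilon>" by (simp add: u_def)
    ultimately show ?case using t0(3)[OF elim(2)] by (simp only: pos_divide_le_eq)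
  qed
qed

lemma average_ge_of_recursion:
  fixes x g :: "nat \<Rightarrow> real" and n :: nat
  assumes \<gamma>: "0 \<le> \<gamma>"
    and rec: "\<And>t. x (Suc t) \<ge> x t - \<gamma> * x t / real (n + t) + g t"
    and g: "\<And>\<epsilon>. 0 < \<epsilon> \<Longrightarrow> eventually (\<lambda>t. g t \<ge> l - \<epsilon>) sequentially"
    and \<epsilon>: "0 < \<epsilon>"
  shows "eventually (\<lambda>t. x t / real (n + t) \<ge> l / (1 + \<gamma>) - \<epsilon>) sequentially"
proof -
  have "eventually (\<lambda>t. (- x t) / real (n + t) \<le> (- l) / (1 + \<gamma>) + \<epsilon>) sequentially"
  proof (rule average_le_of_recursion[where g = "\<lambda>t. - g t"])
    show "- x (Suc t) \<le> - x t - \<gamma> * - x t / real (n + t) + - g t" for t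
      using rec[of t] by simp
    show "eventually (\<lambda>t. - g t \<le> - l + e) sequentially" if "0 < e" for e
      using g[OF that] by eventually_elim simp
  qed fact+
  then show ?thesis by eventually_elim simp
qed

text \<open>The product of the factors decays like a negative power of \<open>j\<close>: from
  \<open>1 - x \<le> exp (- x)\<close> and \<open>ln (j + 2) - ln (j + 1) \<le> 1 / (j + 1)\<close>,
  the sequence \<open>z j * (real j + 1) powr \<theta>\<close> does not increase.\<close>

lemma contraction_harmonic_tendsto_0:
  fixes z :: "nat \<Rightarrow> real"
  assumes \<theta>: "0 < \<theta>" and z: "\<And>j. 0 \<le> z j"
    and rec: "\<And>j. J \<le> j \<Longrightarrow> z (Suc j) \<le> (1 - \<theta> / (real j + 1)) * z j"
  shows "z \<longlonglongrightarrow> 0"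
proof -
  have factor: "(1 - \<theta> / (real j + 1)) * (real j + 2) powr \<theta> \<le> (real j + 1) powr \<theta>" for j
  proof -
    have "ln ((real j + 2) / (real j + 1)) \<le> (real j + 2) / (real j + 1) - 1"
      by (intro ln_le_minus_one) simp
    then have ln: "ln (real j + 2) \<le> ln (real j + 1) + 1 / (real j + 1)"
      by (simp add: ln_div field_simps)
    have "(1 - \<theta> / (real j + 1)) * (real j + 2) powr \<theta>
       \<le> exp (- (\<theta> / (real j + 1))) * (real j + 2) powr \<theta>"
      using exp_ge_add_one_self[of "- (\<theta> / (real j + 1))"] by (intro mult_right_mono) auto
    also have "\<dots> = exp (\<theta> * ln (real j + 2) - \<theta> * (1 / (real j + 1)))"
      by (simp add: powr_def mult_exp_exp)
    also have "\<dots> \<le> exp (\<theta> * ln (real j + 1))"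
      using mult_left_mono[OF ln, of \<theta>] \<theta> by (simp add: algebra_simps)
    finally show ?thesis by (simp add: powr_def mult.commute)
  qed
  have bound: "z j * (real j + 1) powr \<theta> \<le> z J * (real J + 1) powr \<theta>" if "J \<le> j" for j
    using that
  proof (induction j rule: dec_induct)
    case (step j)
    have "z (Suc j) * (real (Suc j) + 1) powr \<theta>
       \<le> (1 - \<theta> / (real j + 1)) * z j * (real j + 2) powr \<theta>"
      using rec[OF step(1)] by (simp add: mult_right_mono add.commute)
    also have "\<dots> = z j * ((1 - \<theta> / (real j + 1)) * (real j + 2) powr \<theta>)" by simp
    also have "\<dots> \<le> z j * (real j + 1) powr \<theta>"
      using factor z by (intro mult_left_mono) auto
    finally show ?case using step by simp
  qed simp
  define C where "C = z J * (real J + 1) powr \<theta>"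
  have "eventually (\<lambda>j. z j \<le> C * (real j + 1) powr - \<theta>) sequentially"
    using eventually_ge_at_top[of J]
  proof eventually_elim
    case (elim j)
    have "z j * (real j + 1) powr \<theta> \<le> C" using bound[OF elim] by (simp add: C_def)
    then show ?case by (simp add: powr_minus field_simps)
  qed
  moreover have "(\<lambda>j. C * (real j + 1) powr - \<theta>) \<longlonglongrightarrow> 0"
    using \<theta> by real_asymp
  ultimately show ?thesis
    using z by (intro tendsto_sandwich[of "\<lambda>_. 0" z]) auto
qed

text \<open>Without \<open>r\<close> the factor is \<open>1 - (1 - c) / d\<close> with
  \<open>d\<close> of at most linear growth, so the products tend to 0 because \<open>c < 1\<close>.
  A perturbation below \<open>\<eta> * (1 - c)\<close> cannot push \<open>y\<close> above the level
  \<eta>, so the contraction is applied to the excess \<open>z\<close> over \<eta>.\<close>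

lemma tail_recursion_tendsto_0:
  fixes y r :: "nat \<Rightarrow> real"
  assumes c: "0 \<le> c" "c < 1" and b: "0 \<le> b" and y: "\<And>j. 0 \<le> y j"
    and rec: "\<And>j. y (Suc j) * (1 + c * (real j - 1) + b) = (c * real j + b) * y j + r j"
    and r: "r \<longlonglongrightarrow> 0"
  shows "y \<longlonglongrightarrow> 0"
proof (rule LIMSEQ_I)
  fix \<epsilon> :: real assume "0 < \<epsilon>"
  define \<eta> where "\<eta> = \<epsilon> / 2"
  \<comment> \<open>\<open>1 - c\<close> is the gap between the two coefficients of the recursion;
    \<open>1 + b\<close> comes from \<open>d \<le> (1 + b) * (real j + 1)\<close>.\<close>
  define \<theta> where "\<theta> = (1 - c) / (1 + b)"
  define z where "z j = max 0 (y j - \<eta>)" for j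
  have \<eta>: "0 < \<eta>" and \<theta>: "0 < \<theta>" using \<open>0 < \<epsilon>\<close> c b by (auto simp: \<eta>_def \<theta>_def)
  have "eventually (\<lambda>j. r j < \<eta> * (1 - c)) sequentially"
    using r \<eta> c by (intro order_tendstoD(2)[of r 0]) auto
  then obtain J where J: "\<And>j. J \<le> j \<Longrightarrow> r j < \<eta> * (1 - c)"
    by (auto simp: eventually_sequentially)
  have "z \<longlonglongrightarrow> 0"
  proof (rule contraction_harmonic_tendsto_0[OF \<theta>])
    show "0 \<le> z j" for j by (simp add: z_def)
    fix j assume "J \<le> j"
    define d where "d = 1 + c * (real j - 1) + b"
    have "0 \<le> c * real j" using c by simp
    moreover have "d = 1 + c * real j - c + b" by (simp add: d_def algebra_simps)
    ultimately have d: "0 < d" "c * real j + b = d - (1 - c)" "1 - c \<le> d"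
      using c b by linarith+
    have "c * real j \<le> real j" "0 \<le> b * real j" using c b by (auto simp: mult_left_le_one_le)
    then have "d \<le> (1 + b) * (real j + 1)" using c by (simp add: d_def algebra_simps)
    then have \<theta>_le: "\<theta> / (real j + 1) \<le> (1 - c) / d"
      using c b d unfolding \<theta>_def divide_divide_eq_left by (intro divide_left_mono) auto
    have "(y (Suc j) - \<eta>) * d \<le> (d - (1 - c)) * (y j - \<eta>)"
    proof -
      have "y (Suc j) * d = (d - (1 - c)) * y j + r j"
        using rec[of j, folded d_def, unfolded d(2)] .
      then show ?thesis using J[OF \<open>J \<le> j\<close>] by (simp add: algebra_simps)
    qed
    then have "y (Suc j) - \<eta> \<le> (1 - (1 - c) / d) * (y j - \<eta>)"
      using d by (simp add: field_simps)
    also have "\<dots> \<le> (1 - (1 - c) / d) * z j"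
      using d by (intro mult_left_mono) (auto simp: z_def)
    also have "\<dots> \<le> (1 - \<theta> / (real j + 1)) * z j"
      using \<theta>_le by (intro mult_right_mono) (auto simp: z_def)
    finally have "y (Suc j) - \<eta> \<le> (1 - \<theta> / (real j + 1)) * z j" .
    moreover have "0 \<le> (1 - \<theta> / (real j + 1)) * z j"
    proof (intro mult_nonneg_nonneg)
      have "(1 - c) / d \<le> 1" using d by simp
      then show "0 \<le> 1 - \<theta> / (real j + 1)" using \<theta>_le by linarith
    qed (simp add: z_def)
    ultimately show "z (Suc j) \<le> (1 - \<theta> / (real j + 1)) * z j" by (simp add: z_def)
  qed
  then have "eventually (\<lambda>j. z j < \<eta>) sequentially" using \<eta> by (intro order_tendstoD(2)) auto
  then obtain j0 where "\<And>j. j0 \<le> j \<Longrightarrow> z j < \<eta>" by (auto simp: eventually_sequentially)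
  then have "y j < \<eta> + \<eta>" if "j0 \<le> j" for j
    using that by (fastforce simp: z_def)
  then have "norm (y j - 0) < \<epsilon>" if "j0 \<le> j" for j
    using that y[of j] by (simp add: \<eta>_def)
  then show "\<exists>j0. \<forall>j\<ge>j0. norm (y j - 0) < \<epsilon>" by blast
qed

text \<open>Replaces a random denominator \<open>d\<close> by a deterministic \<open>e\<close>. A
  lower bound on \<open>d\<close> is avoided because \<open>y / d\<close> is at most 1; for
  \<open>d = 0\<close> also \<open>y = 0\<close>.\<close>

lemma abs_divide_diff_le:
  fixes y d e :: real
  assumes "0 \<le> y" "y \<le> d" "0 < e"
  shows "\<bar>y / d - y / e\<bar> \<le> \<bar>d - e\<bar> / e"
proof (cases "d = 0")
  case False
  then have "0 < d" using assms by linarith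
  then have "y / d - y / e = y / d * ((e - d) / e)"
    using assms by (simp add: field_simps)
  then have "\<bar>y / d - y / e\<bar> = y / d * (\<bar>d - e\<bar> / e)"
    using assms \<open>0 < d\<close> by (simp only: abs_mult abs_divide) (simp add: abs_minus_commute)
  also have "\<dots> \<le> 1 * (\<bar>d - e\<bar> / e)"
    using assms \<open>0 < d\<close> by (intro mult_right_mono) auto
  finally show ?thesis by simp
qed (use assms in simp)

section \<open>Binomial expectations\<close>

lemma expectation_binomial_real:
  assumes "0 \<le> q" "q \<le> 1"
  shows "measure_pmf.expectation (binomial_pmf n q) real = real n * q"
proof (induction n)
  case 0
  then show ?case using assms by (simp add: binomial_pmf_0)
next
  case (Suc n)
  have q: "q \<in> {0..1}" using assms by simp
  have fin: "finite (set_pmf (binomial_pmf n q))" using q by (rule finite_set_pmf_binomial_pmf)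
  have eq: "binomial_pmf (Suc n) q = bind_pmf (bernoulli_pmf q)
     (\<lambda>b. map_pmf (\<lambda>k. if b then k + 1 else k) (binomial_pmf n q))"
    using q by (auto simp: binomial_pmf_Suc map_pmf_def intro!: bind_pmf_cong)
  have plus: "measure_pmf.expectation (binomial_pmf n q) (\<lambda>k. 1 + real k) = 1 + real n * q"
    using Suc fin by (subst Bochner_Integration.integral_add) (auto intro: integrable_measure_pmf_finite)
  show ?case
    unfolding eq
    by (subst pmf_expectation_bind[of UNIV]) (use assms fin plus Suc in \<open>auto simp: UNIV_bool algebra_simps\<close>)
qed

lemma square_expectation_le:
  fixes f :: "'a \<Rightarrow> real"
  assumes "finite (set_pmf M)"
  shows "(measure_pmf.expectation M f)\<^sup>2 \<le> measure_pmf.expectation M (\<lambda>x. (f x)\<^sup>2)"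
  using measure_pmf.variance_eq[OF integrable_measure_pmf_finite[OF assms]
      integrable_measure_pmf_finite[OF assms], of f] measure_pmf.variance_positive[of M f]
  by simp

text \<open>Mean contribution to \<open>tail_sum j\<close> of a new node that has selected
  \<open>k\<close> nodes.\<close>

definition binomial_tail :: "real \<Rightarrow> nat \<Rightarrow> nat \<Rightarrow> real" where
  "binomial_tail q j k = measure_pmf.expectation (binomial_pmf k q) (\<lambda>r. real (Suc r - j))"

lemma binomial_tail_bounds:
  assumes "0 \<le> q" "q \<le> 1"
  shows "0 \<le> binomial_tail q j k" "binomial_tail q j k \<le> 1 + real k"
proof -
  have "r \<le> k" if "r \<in> set_pmf (binomial_pmf k q)" for r
    using that assms by (auto simp: set_pmf_binomial_eq split: if_splits)
  then have "measure_pmf.expectation (binomial_pmf k q) (\<lambda>r. real (Suc r - j)) \<le>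
    measure_pmf.expectation (binomial_pmf k q) (\<lambda>r. 1 + real k)"
    using assms by (intro expectation_pmf_mono) force+
  then show "binomial_tail q j k \<le> 1 + real k" by (simp add: binomial_tail_def)
qed (simp add: binomial_tail_def)

lemma binomial_tail_eq_0:
  assumes "0 \<le> q" "q \<le> 1" "k < j"
  shows "binomial_tail q j k = 0"
proof -
  have "r \<le> k" if "r \<in> set_pmf (binomial_pmf k q)" for r
    using that assms by (auto simp: set_pmf_binomial_eq split: if_splits)
  then have "binomial_tail q j k = measure_pmf.expectation (binomial_pmf k q) (\<lambda>r. 0)"
    unfolding binomial_tail_def using assms(3) by (intro expectation_pmf_cong) force
  then show ?thesis by simp
qed

lemma binomial_tail_1:
  assumes "0 \<le> q" "q \<le> 1"
  shows "binomial_tail q 1 k = q * real k"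
  using expectation_binomial_real[OF assms] by (simp add: binomial_tail_def)

section \<open>The model under its standing assumptions\<close>

locale mixed_attachment =
  fixes p q :: real and A :: "nat pmf" and G\<^sub>0 :: "nat pair_pre_digraph"
  assumes seed: "pair_fin_digraph G\<^sub>0" "pverts G\<^sub>0 \<noteq> {}"
    and p: "0 \<le> p" "p \<le> 1"
    and q: "0 < q" "q \<le> 1"
    and integrable_A: "integrable (measure_pmf A) real"
    and expectation_A_pos: "0 < measure_pmf.expectation A real"
begin

lemma q_nonneg: "0 \<le> q"
  using q by simp

abbreviation net :: "nat \<Rightarrow> nat pair_pre_digraph pmf" where
  "net t \<equiv> network p q A G\<^sub>0 t"

definition num :: "nat \<Rightarrow> nat" where
  "num t = card (pverts G\<^sub>0) + t"

definition EA :: real where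
  "EA = measure_pmf.expectation A real"

definition m :: real where
  "m = (1 + q) * EA"

definition mean_tail :: "nat \<Rightarrow> nat \<Rightarrow> real" where
  "mean_tail j t = measure_pmf.expectation (net t) (tail_sum j)"

lemma EA_pos: "0 < EA"
  using expectation_A_pos by (simp add: EA_def)

lemma m_pos: "0 < m"
  using EA_pos q by (simp add: m_def)

lemma num_pos: "0 < num t"
  using seed pair_fin_digraph.pair_finite_verts[OF seed(1)] by (simp add: num_def card_gt_0_iff)

lemma network_support:
  assumes "G \<in> set_pmf (net t)"
  shows "pair_fin_digraph G \<and> card (pverts G) = num t"
  using assms
proof (induction t arbitrary: G)
  case 0
  then show ?case using seed by (simp add: num_def)
next
  case (Suc t)
  then obtain H a where H: "H \<in> set_pmf (net t)" and G: "G \<in> set_pmf (evolve p q H a)"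
    by (simp only: network.simps set_bind_pmf) blast
  from Suc.IH[OF H] have IH: "pair_fin_digraph H" "card (pverts H) = num t" by auto
  obtain S R where "S \<subseteq> pverts H" "R \<subseteq> S" "G = add_node H S R"
    using IH(1) p G by (rule evolve_support)
  then show ?case
    using pair_fin_digraph_add_node[OF IH(1)] card_pverts_add_node[OF IH(1)] IH(2)
    by (simp add: num_def)
qed

text \<open>\<open>A\<close> may have infinite support, but a step sees \<open>a\<close> only
  through subsets of a finite node set. Hence every real function of the network is
  integrable.\<close>

lemma finite_set_pmf_network: "finite (set_pmf (net t))"
proof (induction t)
  case (Suc t)
  let ?B = "\<Union>H\<in>set_pmf (net t). (\<lambda>(S, R). add_node H S R) ` (Pow (pverts H) \<times> Pow (pverts H))"
  have "set_pmf (net (Suc t)) \<subseteq> ?B"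
  proof
    fix G assume "G \<in> set_pmf (net (Suc t))"
    then obtain H a where H: "H \<in> set_pmf (net t)" and G: "G \<in> set_pmf (evolve p q H a)"
      by (simp only: network.simps set_bind_pmf) blast
    obtain S R where "S \<subseteq> pverts H" "R \<subseteq> S" "G = add_node H S R"
      using network_support[OF H, THEN conjunct1] p G by (rule evolve_support)
    then have "(S, R) \<in> Pow (pverts H) \<times> Pow (pverts H)" "G = (\<lambda>(S, R). add_node H S R) (S, R)"
      by auto
    then show "G \<in> ?B" using H by blast
  qed
  moreover have "finite ?B"
    using Suc network_support pair_fin_digraph.pair_finite_verts
    by (intro finite_UN_I finite_imageI finite_cartesian_product) auto
  ultimately show ?case by (rule finite_subset)
qed simp

lemma integrable_network [simp]: "integrable (measure_pmf (net t)) (f :: _ \<Rightarrow> real)"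
  by (rule integrable_measure_pmf_finite[OF finite_set_pmf_network])

lemma abs_le_sum_network_Suc:
  fixes f :: "nat pair_pre_digraph \<Rightarrow> real"
  assumes "G \<in> set_pmf (net t)" "a \<in> set_pmf A" "H \<in> set_pmf (evolve p q G a)"
  shows "\<bar>f H\<bar> \<le> (\<Sum>X\<in>set_pmf (net (Suc t)). \<bar>f X\<bar>)"
proof (rule member_le_sum)
  show "H \<in> set_pmf (net (Suc t))"
    using assms by (simp only: network.simps set_bind_pmf) blast
qed (auto simp: finite_set_pmf_network simp del: network.simps)

lemma expectation_network_Suc:
  fixes f :: "nat pair_pre_digraph \<Rightarrow> real"
  shows "measure_pmf.expectation (net (Suc t)) f =
    measure_pmf.expectation (net t) (\<lambda>G. measure_pmf.expectation A
      (\<lambda>a. measure_pmf.expectation (evolve p q G a) f))"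
proof -
  let ?C = "\<Sum>X\<in>set_pmf (net (Suc t)). \<bar>f X\<bar>"
  have "measure_pmf.expectation (net (Suc t)) f =
    measure_pmf.expectation (net t) (\<lambda>G. measure_pmf.expectation (bind_pmf A (evolve p q G)) f)"
    unfolding network.simps
    by (rule expectation_bind_pmf[where C = ?C])
       (use abs_le_sum_network_Suc[of _ t _ _ f] in \<open>auto simp del: network.simps\<close>)
  also have "\<dots> = measure_pmf.expectation (net t) (\<lambda>G. measure_pmf.expectation A
      (\<lambda>a. measure_pmf.expectation (evolve p q G a) f))"
  proof (rule expectation_pmf_cong)
    fix G assume G: "G \<in> set_pmf (net t)"
    show "measure_pmf.expectation (bind_pmf A (evolve p q G)) f =
      measure_pmf.expectation A (\<lambda>a. measure_pmf.expectation (evolve p q G a) f)"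
      by (rule expectation_bind_pmf) (rule abs_le_sum_network_Suc[OF G])
  qed
  finally show ?thesis .
qed

section \<open>The law of large numbers for the number of edges\<close>

text \<open>Law of the increment of the total in-degree at \<open>n\<close> nodes;
  \<open>min a n\<close> because \<open>select\<close> stops when all nodes are chosen.\<close>

definition new_edges :: "nat \<Rightarrow> nat pmf" where
  "new_edges n = bind_pmf A (\<lambda>a. map_pmf (\<lambda>r. min a n + r) (binomial_pmf (min a n) q))"

lemma binomial_support: "r \<in> set_pmf (binomial_pmf k q) \<Longrightarrow> r \<le> k"
  using q by (auto simp: set_pmf_binomial_eq split: if_splits)

lemma integrable_binomial: "integrable (measure_pmf (binomial_pmf k q)) (f :: nat \<Rightarrow> real)"
  using q by (intro integrable_binomial_pmf) auto

lemma new_edges_le: "z \<in> set_pmf (new_edges n) \<Longrightarrow> z \<le> 2 * n"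
  by (fastforce simp: new_edges_def dest: binomial_support)

lemma finite_new_edges: "finite (set_pmf (new_edges n))"
  by (rule finite_subset[of _ "{..2 * n}"]) (auto dest: new_edges_le)

lemma expectation_new_edges:
  fixes f :: "nat \<Rightarrow> real"
  shows "measure_pmf.expectation (new_edges n) f = measure_pmf.expectation A
     (\<lambda>a. measure_pmf.expectation (binomial_pmf (min a n) q) (\<lambda>r. f (min a n + r)))"
proof -
  have "\<bar>f z\<bar> \<le> (\<Sum>x\<le>2 * n. \<bar>f x\<bar>)"
    if "a \<in> set_pmf A" "z \<in> set_pmf (map_pmf (\<lambda>r. min a n + r) (binomial_pmf (min a n) q))" for a z
  proof -
    have "z \<in> set_pmf (new_edges n)" unfolding new_edges_def set_bind_pmf using that by blast
    then have "z \<le> 2 * n" by (rule new_edges_le)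
    then show ?thesis by (intro member_le_sum[of z "{..2 * n}" "\<lambda>x. \<bar>f x\<bar>"]) auto
  qed
  then show ?thesis unfolding new_edges_def by (subst expectation_bind_pmf) auto
qed

lemma expectation_total_degree_Suc:
  fixes \<phi> :: "real \<Rightarrow> real"
  shows "measure_pmf.expectation (net (Suc t)) (\<lambda>G. \<phi> (tail_sum 1 G)) =
    measure_pmf.expectation (net t) (\<lambda>G. measure_pmf.expectation (new_edges (num t))
      (\<lambda>z. \<phi> (tail_sum 1 G + real z)))"
  unfolding expectation_network_Suc expectation_new_edges
proof (rule expectation_pmf_cong, rule expectation_pmf_cong)
  fix G a assume "G \<in> set_pmf (net t)"
  then have G: "pair_fin_digraph G" "card (pverts G) = num t" using network_support by auto
  have "measure_pmf.expectation (evolve p q G a) (\<lambda>G. \<phi> (tail_sum 1 G)) =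
     measure_pmf.expectation (map_pmf (tail_sum 1) (evolve p q G a)) \<phi>"
    by simp
  also have "\<dots> = measure_pmf.expectation (binomial_pmf (min a (num t)) q)
      (\<lambda>r. \<phi> (tail_sum 1 G + real (min a (num t) + r)))"
    unfolding map_total_degree_evolve[OF G(1) p q_nonneg q(2)] G(2) by (simp add: add.assoc)
  finally show "measure_pmf.expectation (evolve p q G a) (\<lambda>G. \<phi> (tail_sum 1 G)) = \<dots>" .
qed

lemma min_A_tendsto: "(\<lambda>n. measure_pmf.expectation A (\<lambda>a. real (min a n))) \<longlonglongrightarrow> EA"
  unfolding EA_def
proof (rule integral_dominated_convergence[where w = real])
  show "AE a in measure_pmf A. (\<lambda>n. real (min a n)) \<longlonglongrightarrow> real a"
  proof (rule AE_I2)
    fix a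
    have "eventually (\<lambda>n. real (min a n) = real a) sequentially"
      using eventually_ge_at_top[of a] by eventually_elim simp
    then show "(\<lambda>n. real (min a n)) \<longlonglongrightarrow> real a" by (rule tendsto_eventually)
  qed
qed (use integrable_A in auto)

text \<open>Replaces a finite second moment: \<open>min a n * min a n \<le> a * n\<close> gives the
  integrable majorant \<open>a\<close>, and for fixed \<open>a\<close> the quotient tends to
  0.\<close>

lemma min_A_square_tendsto:
  "(\<lambda>n. measure_pmf.expectation A (\<lambda>a. (real (min a n))\<^sup>2 / real n)) \<longlonglongrightarrow> 0"
proof -
  have "(\<lambda>n. measure_pmf.expectation A (\<lambda>a. (real (min a n))\<^sup>2 / real n)) \<longlonglongrightarrow>
    measure_pmf.expectation A (\<lambda>_. 0)"
  proof (rule integral_dominated_convergence[where w = real])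
    show "AE a in measure_pmf A. (\<lambda>n. (real (min a n))\<^sup>2 / real n) \<longlonglongrightarrow> 0"
    proof (rule AE_I2)
      fix a
      have "eventually (\<lambda>n. (real a)\<^sup>2 / real n = (real (min a n))\<^sup>2 / real n) sequentially"
        using eventually_ge_at_top[of a] by eventually_elim simp
      moreover have "(\<lambda>n. (real a)\<^sup>2 / real n) \<longlonglongrightarrow> 0" by real_asymp
      ultimately show "(\<lambda>n. (real (min a n))\<^sup>2 / real n) \<longlonglongrightarrow> 0"
        by (rule Lim_transform_eventually[rotated])
    qed
    show "AE a in measure_pmf A. norm ((real (min a n))\<^sup>2 / real n) \<le> real a" for n
    proof (rule AE_I2)
      fix a
      have "real (min a n) * real (min a n) \<le> real a * real n" by (intro mult_mono) auto
      then show "norm ((real (min a n))\<^sup>2 / real n) \<le> real a"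
        by (cases "n = 0") (simp_all add: power2_eq_square pos_divide_le_eq)
    qed
  qed (use integrable_A in auto)
  then show ?thesis by simp
qed

lemma integrable_min_A: "integrable (measure_pmf A) (\<lambda>a. f (min a n) :: real)"
proof (rule integrable_pmf_bounded)
  show "\<bar>f (min a n)\<bar> \<le> (\<Sum>k\<le>n. \<bar>f k\<bar>)" for a
    by (rule member_le_sum[of _ "{..n}" "\<lambda>k. \<bar>f k\<bar>"]) auto
qed

lemma expectation_new_edges_real:
  "measure_pmf.expectation (new_edges n) real =
     (1 + q) * measure_pmf.expectation A (\<lambda>a. real (min a n))"
proof -
  have "measure_pmf.expectation (binomial_pmf k q) (\<lambda>r. real (k + r)) = (1 + q) * real k" for k
    using expectation_binomial_real[OF q_nonneg q(2), of k] integrable_binomial[of k real]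
    by (simp add: algebra_simps)
  then show ?thesis by (simp add: expectation_new_edges)
qed

text \<open>At most \<open>min a n\<close> selected nodes reciprocate, so an increment is at most
  \<open>2 * min a n\<close>.\<close>

lemma expectation_new_edges_square:
  "measure_pmf.expectation (new_edges n) (\<lambda>z. (real z)\<^sup>2) \<le>
     4 * measure_pmf.expectation A (\<lambda>a. (real (min a n))\<^sup>2)"
proof -
  have "measure_pmf.expectation (binomial_pmf k q) (\<lambda>r. (real (k + r))\<^sup>2) \<le> 4 * (real k)\<^sup>2" for k
  proof -
    have "measure_pmf.expectation (binomial_pmf k q) (\<lambda>r. (real (k + r))\<^sup>2) \<le>
      measure_pmf.expectation (binomial_pmf k q) (\<lambda>r. (2 * real k)\<^sup>2)"
      by (intro expectation_pmf_mono integrable_binomial power_mono) (auto dest: binomial_support)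
    then show ?thesis by (simp add: power_mult_distrib)
  qed
  then have "measure_pmf.expectation (new_edges n) (\<lambda>z. (real z)\<^sup>2) \<le>
      measure_pmf.expectation A (\<lambda>a. 4 * (real (min a n))\<^sup>2)"
    unfolding expectation_new_edges
    by (intro expectation_pmf_mono integrable_min_A[of "\<lambda>k. 4 * (real k)\<^sup>2"]
        integrable_min_A[of "\<lambda>k. measure_pmf.expectation (binomial_pmf k q) (\<lambda>r. (real (k + r))\<^sup>2)"])
  then show ?thesis by simp
qed

lemma num_tendsto: "filterlim num at_top sequentially"
  unfolding num_def by (rule filterlim_at_top_mono[OF filterlim_ident]) auto

lemma mean_tail_1_Suc:
  "mean_tail 1 (Suc t) = mean_tail 1 t + (1 + q) * measure_pmf.expectation A (\<lambda>a. real (min a (num t)))"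
  unfolding mean_tail_def using expectation_total_degree_Suc[of t "\<lambda>y. y"]
  by (simp add: integrable_measure_pmf_finite[OF finite_new_edges] expectation_new_edges_real
      del: network.simps)

text \<open>Cesaro averaging of the mean increments, that is, the averaging lemmas with \<gamma> =
  0.\<close>

lemma mean_tail_1_tendsto: "(\<lambda>t. mean_tail 1 t / real (num t)) \<longlonglongrightarrow> m"
proof -
  define g where "g t = (1 + q) * measure_pmf.expectation A (\<lambda>a. real (min a (num t)))" for t
  have g: "g \<longlonglongrightarrow> m"
    unfolding g_def m_def
    by (intro tendsto_mult tendsto_const filterlim_compose[OF min_A_tendsto num_tendsto])
  have up: "eventually (\<lambda>t. g t \<le> m + e) sequentially" if "0 < e" for e
    using order_tendstoD(2)[OF g, of "m + e"] that by (auto elim!: eventually_mono)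
  have lo: "eventually (\<lambda>t. g t \<ge> m - e) sequentially" if "0 < e" for e
    using order_tendstoD(1)[OF g, of "m - e"] that by (auto elim!: eventually_mono)
  show ?thesis
  proof (rule order_tendstoI)
    fix u assume "m < u"
    have "eventually (\<lambda>t. mean_tail 1 t / real (card (pverts G\<^sub>0) + t) \<le> m / (1 + 0) + (u - m) / 2) sequentially"
      by (rule average_le_of_recursion[where g = g])
         (use up \<open>m < u\<close> mean_tail_1_Suc in \<open>auto simp: g_def\<close>)
    then show "eventually (\<lambda>t. mean_tail 1 t / real (num t) < u) sequentially"
      unfolding num_def by eventually_elim (use \<open>m < u\<close> in \<open>simp add: field_simps\<close>)
  next
    fix u assume "u < m"
    have "eventually (\<lambda>t. mean_tail 1 t / real (card (pverts G\<^sub>0) + t) \<ge> m / (1 + 0) - (m - u) / 2) sequentially"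
      by (rule average_ge_of_recursion[where g = g])
         (use lo \<open>u < m\<close> mean_tail_1_Suc in \<open>auto simp: g_def\<close>)
    then show "eventually (\<lambda>t. u < mean_tail 1 t / real (num t)) sequentially"
      unfolding num_def by eventually_elim (use \<open>u < m\<close> in \<open>simp add: field_simps\<close>)
  qed
qed

definition total_variance :: "nat \<Rightarrow> real" where
  "total_variance t = measure_pmf.expectation (net t) (\<lambda>G. (tail_sum 1 G - mean_tail 1 t)\<^sup>2)"

text \<open>The increment is independent of the past, so variances add; that of the increment is at
  most its second moment.\<close>

lemma total_variance_Suc:
  "total_variance (Suc t) \<le> total_variance t
     + 4 * measure_pmf.expectation A (\<lambda>a. (real (min a (num t)))\<^sup>2)"
proof -
  let ?Z = "new_edges (num t)"
  define \<mu> where "\<mu> = measure_pmf.expectation ?Z real"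
  define s where "s = measure_pmf.expectation ?Z (\<lambda>z. (real z)\<^sup>2)"
  have mean: "mean_tail 1 (Suc t) = mean_tail 1 t + \<mu>"
    by (simp only: mean_tail_1_Suc \<mu>_def expectation_new_edges_real)
  have int: "integrable (measure_pmf ?Z) f" for f :: "nat \<Rightarrow> real"
    by (rule integrable_measure_pmf_finite[OF finite_new_edges])
  have inner: "measure_pmf.expectation ?Z (\<lambda>z. (y + real z - (mean_tail 1 t + \<mu>))\<^sup>2) \<le>
      (y - mean_tail 1 t)\<^sup>2 + s" for y
  proof -
    define d where "d = y - mean_tail 1 t - \<mu>"
    have "measure_pmf.expectation ?Z (\<lambda>z. (y + real z - (mean_tail 1 t + \<mu>))\<^sup>2) =
      measure_pmf.expectation ?Z (\<lambda>z. d\<^sup>2 + (2 * d * real z + (real z)\<^sup>2))"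
      by (intro arg_cong[where f = "measure_pmf.expectation _"] ext)
         (simp add: d_def power2_eq_square algebra_simps)
    also have "\<dots> = d\<^sup>2 + (2 * d * \<mu> + s)"
      by (simp add: int \<mu>_def s_def)
    also have "\<dots> = (y - mean_tail 1 t)\<^sup>2 - \<mu>\<^sup>2 + s"
      by (simp add: d_def power2_eq_square algebra_simps)
    finally show ?thesis by simp
  qed
  have "total_variance (Suc t) = measure_pmf.expectation (net t) (\<lambda>G.
      measure_pmf.expectation ?Z (\<lambda>z. (tail_sum 1 G + real z - (mean_tail 1 t + \<mu>))\<^sup>2))"
    unfolding total_variance_def mean
    using expectation_total_degree_Suc[of t "\<lambda>y. (y - (mean_tail 1 t + \<mu>))\<^sup>2"] .
  also have "\<dots> \<le> measure_pmf.expectation (net t) (\<lambda>G. (tail_sum 1 G - mean_tail 1 t)\<^sup>2 + s)"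
    by (intro expectation_pmf_mono integrable_network inner)
  also have "\<dots> = total_variance t + s"
    by (simp add: total_variance_def)
  finally show ?thesis
    using expectation_new_edges_square[of "num t"] by (simp add: s_def)
qed

lemma total_variance_tendsto: "(\<lambda>t. total_variance t / (real (num t))\<^sup>2) \<longlonglongrightarrow> 0"
proof (rule LIMSEQ_I)
  fix \<epsilon> :: real assume \<epsilon>: "0 < \<epsilon>"
  define s where "s n = measure_pmf.expectation A (\<lambda>a. (real (min a n))\<^sup>2 / real n)" for n
  have "(\<lambda>t. s (num t)) \<longlonglongrightarrow> 0"
    unfolding s_def by (rule filterlim_compose[OF min_A_square_tendsto num_tendsto])
  \<comment> \<open>The factor 4 of \<open>total_variance_Suc\<close> turns \<epsilon> / 8 into
    \<epsilon> / 2; the other half covers the variance accumulated up to \<open>t0\<close>.\<close>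
  then have "eventually (\<lambda>t. s (num t) < \<epsilon> / 8) sequentially"
    using \<epsilon> by (intro order_tendstoD(2)[of _ 0]) auto
  then obtain t0 where t0: "\<And>t. t0 \<le> t \<Longrightarrow> s (num t) < \<epsilon> / 8"
    by (auto simp: eventually_sequentially)
  have step: "total_variance (Suc t) \<le> total_variance t + \<epsilon> / 2 * real (num t)" if "t0 \<le> t" for t
  proof -
    have "measure_pmf.expectation A (\<lambda>a. (real (min a (num t)))\<^sup>2) = s (num t) * real (num t)"
      using num_pos[of t] by (simp add: s_def)
    also have "\<dots> \<le> \<epsilon> / 8 * real (num t)"
      using t0[OF that] by (intro mult_right_mono) auto
    finally show ?thesis using total_variance_Suc[of t] by simp
  qed
  have bound: "total_variance t \<le> total_variance t0 + \<epsilon> / 2 * (real (num t))\<^sup>2" if "t0 \<le> t" for t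
    using that
  proof (induction t rule: dec_induct)
    case (step t)
    \<comment> \<open>Comparison with the increments of the square makes the increments of the
      variance telescope.\<close>
    have "real (num t) \<le> (real (num (Suc t)))\<^sup>2 - (real (num t))\<^sup>2"
      by (simp add: num_def power2_eq_square algebra_simps)
    then have "\<epsilon> / 2 * real (num t) \<le> \<epsilon> / 2 * ((real (num (Suc t)))\<^sup>2 - (real (num t))\<^sup>2)"
      using \<epsilon> by (intro mult_left_mono) auto
    then show ?case
      using step \<open>\<And>t. t0 \<le> t \<Longrightarrow> total_variance (Suc t) \<le> _ t\<close>[OF step(1)] by (simp add: algebra_simps)
  qed (use \<epsilon> in simp)
  have "eventually (\<lambda>t. total_variance t0 < \<epsilon> / 2 * (real (num t))\<^sup>2) sequentially"
    unfolding num_def using \<epsilon> by real_asymp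
  then obtain t1 where t1: "\<And>t. t1 \<le> t \<Longrightarrow> total_variance t0 < \<epsilon> / 2 * (real (num t))\<^sup>2"
    by (auto simp: eventually_sequentially)
  have "norm (total_variance t / (real (num t))\<^sup>2 - 0) < \<epsilon>" if "max t0 t1 \<le> t" for t
  proof -
    have "0 \<le> total_variance t" by (simp add: total_variance_def)
    moreover have "total_variance t < \<epsilon> * (real (num t))\<^sup>2"
      using bound[of t] t1[of t] that by simp
    ultimately show ?thesis using num_pos[of t] by (simp add: pos_divide_less_eq)
  qed
  then show "\<exists>t0. \<forall>t\<ge>t0. norm (total_variance t / (real (num t))\<^sup>2 - 0) < \<epsilon>" by blast
qed

definition degree_error :: "nat \<Rightarrow> real" where
  "degree_error t = measure_pmf.expectation (net t)
     (\<lambda>G. \<bar>tail_sum 1 G - m * real (num t)\<bar>) / (m * real (num t))"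

text \<open>The mean absolute deviation is at most the standard deviation plus the bias of the mean,
  and both are small relative to the number of nodes.\<close>

lemma degree_error_tendsto: "degree_error \<longlonglongrightarrow> 0"
proof -
  let ?h = "\<lambda>t. (sqrt (total_variance t / (real (num t))\<^sup>2) + \<bar>mean_tail 1 t / real (num t) - m\<bar>) / m"
  have "degree_error t \<le> ?h t" for t
  proof -
    let ?x = "mean_tail 1 t" and ?N = "real (num t)"
    have N: "0 < ?N" using num_pos by simp
    have "measure_pmf.expectation (net t) (\<lambda>G. \<bar>tail_sum 1 G - m * ?N\<bar>) \<le>
      measure_pmf.expectation (net t) (\<lambda>G. \<bar>tail_sum 1 G - ?x\<bar> + \<bar>?x - m * ?N\<bar>)"
      by (intro expectation_pmf_mono integrable_network) auto
    also have "\<dots> = measure_pmf.expectation (net t) (\<lambda>G. \<bar>tail_sum 1 G - ?x\<bar>) + \<bar>?x - m * ?N\<bar>"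
      by simp
    also have "measure_pmf.expectation (net t) (\<lambda>G. \<bar>tail_sum 1 G - ?x\<bar>) \<le> sqrt (total_variance t)"
      using square_expectation_le[OF finite_set_pmf_network, of t "\<lambda>G. \<bar>tail_sum 1 G - ?x\<bar>"]
      by (intro real_le_rsqrt) (simp add: total_variance_def)
    finally have "degree_error t \<le> (sqrt (total_variance t) + \<bar>?x - m * ?N\<bar>) / (m * ?N)"
      unfolding degree_error_def using m_pos N by (simp add: divide_right_mono)
    also have "\<dots> = ?h t"
    proof -
      have "?x - m * ?N = (?x / ?N - m) * ?N" using N by (simp add: left_diff_distrib)
      then have "\<bar>?x - m * ?N\<bar> = \<bar>?x / ?N - m\<bar> * ?N"
        using N by (simp add: abs_mult)
      then show ?thesis using N m_pos by (simp add: real_sqrt_divide field_simps)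
    qed
    finally show ?thesis .
  qed
  moreover have "0 \<le> degree_error t" for t
    using m_pos num_pos by (simp add: degree_error_def)
  moreover have "?h \<longlonglongrightarrow> (sqrt 0 + \<bar>m - m\<bar>) / m"
    by (intro tendsto_intros total_variance_tendsto mean_tail_1_tendsto) (use m_pos in auto)
  ultimately show ?thesis
    by (intro tendsto_sandwich[of "\<lambda>_. 0" degree_error _ ?h]) auto
qed

end

context mixed_attachment
begin

section \<open>Asymptotics of the expected tail sums\<close>

text \<open>With the total in-degree replaced by \<open>m * n\<close>, a node of in-degree
  \<open>d\<close> gains edges at rate \<open>(pref_rate * d + unif_rate) / n\<close>; indeed
  \<open>pref_rate\<close> is \<open>p * EA / m\<close>.\<close>

definition pref_rate :: real where
  "pref_rate = p / (1 + q)"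

definition unif_rate :: real where
  "unif_rate = (1 - p) * EA"

definition source :: "nat \<Rightarrow> nat \<Rightarrow> real" where
  "source j t = measure_pmf.expectation A (\<lambda>a. binomial_tail q j (min a (num t)))"

definition limit_source :: "nat \<Rightarrow> real" where
  "limit_source j = measure_pmf.expectation A (binomial_tail q j)"

definition overflow :: "nat \<Rightarrow> real" where
  "overflow M = measure_pmf.expectation A (\<lambda>a. if M < a then real a else 0)"

definition gain :: "nat \<Rightarrow> nat pair_pre_digraph \<Rightarrow> real" where
  "gain j G = measure_pmf.expectation A (\<lambda>a.
     measure_pmf.expectation (select (attach_prob p G) (pverts G) a) (\<lambda>S. real (card (S \<inter> upper j G))))"

text \<open>For \<open>p = 1\<close> the strict inequality rests on \<open>0 < q\<close>. It is the
  \<open>c < 1\<close> of \<open>tail_recursion_tendsto_0\<close>.\<close>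

lemma rates: "0 \<le> pref_rate" "pref_rate < 1" "0 \<le> unif_rate"
  using p q EA_pos by (auto simp: pref_rate_def unif_rate_def)

lemma integrable_Suc_A: "integrable (measure_pmf A) (\<lambda>a. 1 + real a)"
  using integrable_A by simp

lemma integrable_binomial_tail: "integrable (measure_pmf A) (binomial_tail q j)"
  by (rule Bochner_Integration.integrable_bound[OF integrable_Suc_A])
     (use binomial_tail_bounds[OF q_nonneg q(2)] in \<open>auto intro!: AE_I2\<close>)

lemma source_tendsto: "source j \<longlonglongrightarrow> limit_source j"
proof -
  have "(\<lambda>n. measure_pmf.expectation A (\<lambda>a. binomial_tail q j (min a n))) \<longlonglongrightarrow> limit_source j"
    unfolding limit_source_def
  proof (rule integral_dominated_convergence[where w = "\<lambda>a. 1 + real a"])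
    show "AE a in measure_pmf A. (\<lambda>n. binomial_tail q j (min a n)) \<longlonglongrightarrow> binomial_tail q j a"
    proof (rule AE_I2)
      fix a
      have "eventually (\<lambda>n. binomial_tail q j (min a n) = binomial_tail q j a) sequentially"
        using eventually_ge_at_top[of a] by eventually_elim simp
      then show "(\<lambda>n. binomial_tail q j (min a n)) \<longlonglongrightarrow> binomial_tail q j a"
        by (rule tendsto_eventually)
    qed
    show "AE a in measure_pmf A. norm (binomial_tail q j (min a n)) \<le> 1 + real a" for n
    proof (rule AE_I2)
      fix a
      show "norm (binomial_tail q j (min a n)) \<le> 1 + real a"
        using binomial_tail_bounds[OF q_nonneg q(2), of j "min a n"] by simp
    qed
  qed (use integrable_Suc_A in auto)
  from filterlim_compose[OF this num_tendsto] show ?thesis by (simp add: source_def[abs_def])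
qed

lemma limit_source_nonneg: "0 \<le> limit_source j"
  unfolding limit_source_def
  using binomial_tail_bounds[OF q_nonneg q(2)] by (intro integral_nonneg_AE AE_I2)

lemma limit_source_tendsto: "limit_source \<longlonglongrightarrow> 0"
proof -
  have "(\<lambda>j. measure_pmf.expectation A (binomial_tail q j)) \<longlonglongrightarrow> measure_pmf.expectation A (\<lambda>_. 0)"
  proof (rule integral_dominated_convergence[where w = "\<lambda>a. 1 + real a"])
    show "AE a in measure_pmf A. (\<lambda>j. binomial_tail q j a) \<longlonglongrightarrow> 0"
    proof (rule AE_I2)
      fix a
      have "eventually (\<lambda>j. binomial_tail q j a = 0) sequentially"
        using eventually_gt_at_top[of a]
        by eventually_elim (rule binomial_tail_eq_0[OF q_nonneg q(2)])
      then show "(\<lambda>j. binomial_tail q j a) \<longlonglongrightarrow> 0" by (rule tendsto_eventually)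
    qed
    show "AE a in measure_pmf A. norm (binomial_tail q j a) \<le> 1 + real a" for j
      using binomial_tail_bounds[OF q_nonneg q(2), of j] by (intro AE_I2) simp
  qed (use integrable_Suc_A in auto)
  then show ?thesis by (simp add: limit_source_def[abs_def])
qed

lemma limit_source_1: "limit_source 1 = q * EA"
  unfolding limit_source_def EA_def
  by (simp add: binomial_tail_1[OF q_nonneg q(2), abs_def] del: One_nat_def)

lemma integrable_overflow: "integrable (measure_pmf A) (\<lambda>a. if M < a then real a else 0)"
  by (rule Bochner_Integration.integrable_bound[OF integrable_A]) auto

lemma overflow_tendsto: "overflow \<longlonglongrightarrow> 0"
proof -
  have "(\<lambda>M. measure_pmf.expectation A (\<lambda>a. if M < a then real a else 0)) \<longlonglongrightarrow>
    measure_pmf.expectation A (\<lambda>_. 0)"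
  proof (rule integral_dominated_convergence[where w = real])
    show "AE a in measure_pmf A. (\<lambda>M. if M < a then real a else 0) \<longlonglongrightarrow> 0"
    proof (rule AE_I2)
      fix a
      have "eventually (\<lambda>M. (if M < a then real a else 0) = 0) sequentially"
        using eventually_ge_at_top[of a] by eventually_elim simp
      then show "(\<lambda>M. if M < a then real a else 0) \<longlonglongrightarrow> 0" by (rule tendsto_eventually)
    qed
  qed (use integrable_A in auto)
  then show ?thesis by (simp add: overflow_def[abs_def])
qed

lemma integrable_select_card:
  assumes "finite (pverts G)"
  shows "integrable (measure_pmf A) (\<lambda>a.
     measure_pmf.expectation (select (attach_prob p G) (pverts G) a) (\<lambda>S. real (card (S \<inter> upper j G))))"
proof (rule integrable_pmf_bounded)
  fix a
  have card: "card (S \<inter> upper j G) \<le> card (pverts G)" for S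
    using assms by (intro card_mono) (auto simp: upper_def)
  have "measure_pmf.expectation (select (attach_prob p G) (pverts G) a) (\<lambda>S. real (card (S \<inter> upper j G)))
     \<le> measure_pmf.expectation (select (attach_prob p G) (pverts G) a) (\<lambda>S. real (card (pverts G)))"
    using card by (intro expectation_pmf_mono integrable_pmf_bounded[where C = "real (card (pverts G))"]) auto
  then show "\<bar>measure_pmf.expectation (select (attach_prob p G) (pverts G) a)
      (\<lambda>S. real (card (S \<inter> upper j G)))\<bar> \<le> real (card (pverts G))"
    by simp
qed

lemma mean_tail_Suc:
  "mean_tail j (Suc t) = mean_tail j t + measure_pmf.expectation (net t) (gain j) + source j t"
proof -
  have "measure_pmf.expectation A (\<lambda>a. measure_pmf.expectation (evolve p q G a) (tail_sum j))
     = tail_sum j G + gain j G + source j t" if "G \<in> set_pmf (net t)" for G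
  proof -
    have G: "pair_fin_digraph G" "card (pverts G) = num t" using network_support[OF that] by auto
    show ?thesis
      unfolding expectation_tail_sum_evolve[OF G(1) p q_nonneg q(2)] G(2) gain_def source_def
        binomial_tail_def[symmetric]
      using integrable_select_card[OF pair_fin_digraph.pair_finite_verts[OF G(1)]]
        integrable_min_A[of "binomial_tail q j" "num t"]
      by simp
  qed
  then show ?thesis
    unfolding mean_tail_def expectation_network_Suc
    by (subst expectation_pmf_cong) auto
qed

definition upper_weight :: "nat \<Rightarrow> nat pair_pre_digraph \<Rightarrow> real" where
  "upper_weight j G = (\<Sum>u\<in>upper j G. attach_prob p G u)"

lemma gain_le:
  assumes "finite (pverts G)" "2 \<le> j"
  shows "gain j G \<le> EA * upper_weight j G"
proof -
  have "gain j G \<le> measure_pmf.expectation A (\<lambda>a. real a * upper_weight j G)"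
    unfolding gain_def upper_weight_def
    by (intro expectation_pmf_mono integrable_select_card expectation_card_select_upper_le assms p
        integrable_mult_left integrable_A)
  then show ?thesis by (simp add: EA_def)
qed

text \<open>The loss in a single selection is split at \<open>M\<close>: up to \<open>M\<close> it
  is at most \<open>(real M)\<^sup>2 * \<omega>\<close>, beyond \<open>M\<close> at most
  \<open>a\<close>, which adds up to \<open>overflow M\<close>.\<close>

lemma gain_ge:
  assumes "finite (pverts G)" "2 \<le> j"
    and \<omega>: "\<And>v. v \<in> pverts G \<Longrightarrow> attach_prob p G v \<le> \<omega>" "0 \<le> \<omega>"
  shows "EA * upper_weight j G - (overflow M + (real M)\<^sup>2 * \<omega>) \<le> gain j G"
proof -
  let ?o = "\<lambda>a. if M < a then real a else 0"
  have "real a * upper_weight j G - (?o a + (real M)\<^sup>2 * \<omega>) \<le>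
     measure_pmf.expectation (select (attach_prob p G) (pverts G) a) (\<lambda>S. real (card (S \<inter> upper j G)))" for a
  proof -
    have "min (real a) ((real a)\<^sup>2 * \<omega>) \<le> ?o a + (real M)\<^sup>2 * \<omega>"
    proof (cases "M < a")
      case False
      then have "(real a)\<^sup>2 * \<omega> \<le> (real M)\<^sup>2 * \<omega>"
        using \<omega>(2) by (intro mult_right_mono power_mono) auto
      then show ?thesis using False by simp
    qed (use \<omega>(2) in \<open>simp add: min.coboundedI1\<close>)
    then show ?thesis
      using expectation_card_select_upper_ge[OF assms(1) p assms(2) \<omega>, of a]
      unfolding upper_weight_def by linarith
  qed
  then have "measure_pmf.expectation A (\<lambda>a. real a * upper_weight j G - (?o a + (real M)\<^sup>2 * \<omega>)) \<le> gain j G"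
    unfolding gain_def
    using integrable_overflow[of M] integrable_A
    by (intro expectation_pmf_mono integrable_select_card[OF assms(1)]) auto
  moreover have "measure_pmf.expectation A (\<lambda>a. real a * upper_weight j G - (?o a + (real M)\<^sup>2 * \<omega>))
     = EA * upper_weight j G - (overflow M + (real M)\<^sup>2 * \<omega>)"
    using integrable_overflow[of M] integrable_A by (simp add: EA_def overflow_def)
  ultimately show ?thesis by simp
qed

definition rel_error :: "nat \<Rightarrow> nat pair_pre_digraph \<Rightarrow> real" where
  "rel_error t G = \<bar>tail_sum 1 G - m * real (num t)\<bar> / (m * real (num t))"

lemma expectation_rel_error: "measure_pmf.expectation (net t) (rel_error t) = degree_error t"
  by (simp add: rel_error_def[abs_def] degree_error_def)

text \<open>By \<open>sum_deg_upper\<close> the total in-degree of \<open>upper j G\<close> is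
  \<open>j - 1\<close> times \<open>tail_sum (j - 1) G\<close> minus \<open>j - 2\<close> times
  \<open>tail_sum j G\<close>. The index \<open>j = Suc (Suc i)\<close> keeps both coefficients
  nonnegative, as the averaging lemmas require. The error is that of replacing the total in-degree
  by \<open>m * num t\<close>.\<close>

lemma upper_weight_approx:
  assumes G: "pair_fin_digraph G" "card (pverts G) = num t"
  shows "\<bar>EA * upper_weight (Suc (Suc i)) G
     - ((pref_rate * real (Suc i) + unif_rate) * tail_sum (Suc i) G
        - (pref_rate * real i + unif_rate) * tail_sum (Suc (Suc i)) G) / real (num t)\<bar>
     \<le> EA * rel_error t G"
proof -
  let ?j = "Suc (Suc i)" and ?N = "real (num t)"
  have fin: "finite (pverts G)" using G(1) by (rule pair_fin_digraph.pair_finite_verts)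
  have N: "0 < ?N" using num_pos by simp
  define Y where "Y = (\<Sum>v\<in>upper ?j G. real (deg G v))"
  define D where "D = tail_sum 1 G"
  have Y: "Y = tail_sum ?j G + real (Suc i) * (tail_sum (Suc i) G - tail_sum ?j G)"
    using sum_deg_upper[OF fin, of ?j] by (simp add: Y_def)
  have "Y \<le> D"
    unfolding Y_def D_def sum_deg_eq_tail_sum[symmetric]
    using fin by (intro sum_mono2) (auto simp: upper_def)
  then have err: "\<bar>Y / D - Y / (m * ?N)\<bar> \<le> rel_error t G"
    unfolding rel_error_def D_def[symmetric] using m_pos N
    by (intro abs_divide_diff_le) (auto simp: Y_def sum_nonneg)
  have "upper_weight ?j G = p * (Y / D) + (1 - p) * ((tail_sum (Suc i) G - tail_sum ?j G) / ?N)"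
    using card_upper[OF fin, of ?j] by (simp add: upper_weight_def sum_attach_prob G(2) Y_def D_def)
  moreover have "((pref_rate * real (Suc i) + unif_rate) * tail_sum (Suc i) G
        - (pref_rate * real i + unif_rate) * tail_sum ?j G) / ?N
     = EA * (p * (Y / (m * ?N)) + (1 - p) * ((tail_sum (Suc i) G - tail_sum ?j G) / ?N))"
  proof -
    have "1 + q \<noteq> 0" using q by simp
    then have "EA * (p * (Y / (m * ?N))) = pref_rate * Y / ?N"
      using N EA_pos by (simp add: pref_rate_def m_def)
    then show ?thesis
      using N by (simp add: Y unif_rate_def field_simps)
  qed
  ultimately have "EA * upper_weight ?j G
     - ((pref_rate * real (Suc i) + unif_rate) * tail_sum (Suc i) G
        - (pref_rate * real i + unif_rate) * tail_sum ?j G) / ?N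
     = EA * (p * (Y / D - Y / (m * ?N)))"
    by (simp add: algebra_simps)
  also have "\<bar>\<dots>\<bar> = EA * (p * \<bar>Y / D - Y / (m * ?N)\<bar>)"
    using EA_pos p by (simp add: abs_mult)
  also have "\<dots> \<le> EA * (1 * rel_error t G)"
    using EA_pos p err by (intro mult_left_mono mult_mono) auto
  finally show ?thesis by simp
qed

text \<open>A single in-degree is at most \<open>J + tail_sum J G\<close>. Thus a small tail average
  at some index \<open>J\<close> bounds the largest attachment probability.\<close>

lemma attach_prob_bound:
  assumes G: "pair_fin_digraph G" "card (pverts G) = num t" and v: "v \<in> pverts G"
  shows "attach_prob p G v \<le>
    (real J + tail_sum J G) / (m * real (num t)) + rel_error t G + 1 / real (num t)"
proof -
  let ?N = "real (num t)" and ?d = "real (deg G v)" and ?D = "tail_sum 1 G"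
  have fin: "finite (pverts G)" using G(1) by (rule pair_fin_digraph.pair_finite_verts)
  have N: "0 < ?N" using num_pos by simp
  have "?d \<le> ?D"
    unfolding sum_deg_eq_tail_sum[symmetric] using v fin by (intro member_le_sum) auto
  then have "\<bar>?d / ?D - ?d / (m * ?N)\<bar> \<le> rel_error t G"
    unfolding rel_error_def using m_pos N by (intro abs_divide_diff_le) auto
  moreover have "?d / (m * ?N) \<le> (real J + tail_sum J G) / (m * ?N)"
  proof (rule divide_right_mono)
    have "real (Suc (deg G v) - J) \<le> tail_sum J G"
      unfolding tail_sum_def using v fin by (intro member_le_sum) auto
    then show "?d \<le> real J + tail_sum J G" by linarith
  qed (use m_pos N in simp)
  moreover have "attach_prob p G v \<le> ?d / ?D + 1 / ?N"
  proof -
    have "p * (?d / ?D) \<le> 1 * (?d / ?D)"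
      using p by (intro mult_right_mono) (auto simp: tail_sum_nonneg)
    moreover have "(1 - p) * (1 / ?N) \<le> 1 * (1 / ?N)"
      using p by (intro mult_right_mono) auto
    ultimately show ?thesis by (simp add: attach_prob_def sum_deg_eq_tail_sum G(2))
  qed
  ultimately show ?thesis by linarith
qed

lemma mean_tail_Suc_le:
  "mean_tail (Suc (Suc i)) (Suc t) \<le> mean_tail (Suc (Suc i)) t
     - (pref_rate * real i + unif_rate) * mean_tail (Suc (Suc i)) t / real (num t)
     + ((pref_rate * real (Suc i) + unif_rate) * (mean_tail (Suc i) t / real (num t))
        + (EA * degree_error t + source (Suc (Suc i)) t))"
proof -
  let ?j = "Suc (Suc i)" and ?N = "real (num t)"
  have "measure_pmf.expectation (net t) (gain ?j) \<le> measure_pmf.expectation (net t)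
    (\<lambda>G. ((pref_rate * real (Suc i) + unif_rate) * tail_sum (Suc i) G
        - (pref_rate * real i + unif_rate) * tail_sum ?j G) / ?N + EA * rel_error t G)"
  proof (intro expectation_pmf_mono integrable_network)
    fix G assume "G \<in> set_pmf (net t)"
    then have G: "pair_fin_digraph G" "card (pverts G) = num t" using network_support by auto
    show "gain ?j G \<le> ((pref_rate * real (Suc i) + unif_rate) * tail_sum (Suc i) G
        - (pref_rate * real i + unif_rate) * tail_sum ?j G) / ?N + EA * rel_error t G"
      using gain_le[OF pair_fin_digraph.pair_finite_verts[OF G(1)], of ?j]
        upper_weight_approx[OF G, of i] by linarith
  qed
  also have "\<dots> = ((pref_rate * real (Suc i) + unif_rate) * mean_tail (Suc i) t
        - (pref_rate * real i + unif_rate) * mean_tail ?j t) / ?N + EA * degree_error t"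
    by (simp add: mean_tail_def expectation_rel_error)
  finally show ?thesis
    unfolding mean_tail_Suc by (simp add: diff_divide_distrib)
qed

text \<open>The bound on the largest attachment probability is taken in each network separately; it
  enters \<open>gain_ge\<close> linearly, so its expectation involves only
  \<open>mean_tail J\<close> and \<open>degree_error\<close>. \<open>M\<close> and \<open>J\<close>
  stay free until the accuracy is known.\<close>

lemma mean_tail_Suc_ge:
  "mean_tail (Suc (Suc i)) (Suc t) \<ge> mean_tail (Suc (Suc i)) t
     - (pref_rate * real i + unif_rate) * mean_tail (Suc (Suc i)) t / real (num t)
     + ((pref_rate * real (Suc i) + unif_rate) * (mean_tail (Suc i) t / real (num t))
        + (source (Suc (Suc i)) t - EA * degree_error t)
        - (overflow M + (real M)\<^sup>2 * ((real J + mean_tail J t) / (m * real (num t))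
             + degree_error t + 1 / real (num t))))"
proof -
  let ?j = "Suc (Suc i)" and ?N = "real (num t)"
  let ?w = "\<lambda>G. (real J + tail_sum J G) / (m * ?N) + rel_error t G + 1 / ?N"
  have "measure_pmf.expectation (net t)
    (\<lambda>G. ((pref_rate * real (Suc i) + unif_rate) * tail_sum (Suc i) G
        - (pref_rate * real i + unif_rate) * tail_sum ?j G) / ?N - EA * rel_error t G
        - (overflow M + (real M)\<^sup>2 * ?w G)) \<le> measure_pmf.expectation (net t) (gain ?j)"
  proof (intro expectation_pmf_mono integrable_network)
    fix G assume "G \<in> set_pmf (net t)"
    then have G: "pair_fin_digraph G" "card (pverts G) = num t" using network_support by auto
    have fin: "finite (pverts G)" using G(1) by (rule pair_fin_digraph.pair_finite_verts)
    have "0 \<le> ?w G"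
      using m_pos by (intro add_nonneg_nonneg divide_nonneg_nonneg) (auto simp: tail_sum_nonneg rel_error_def)
    then have "EA * upper_weight ?j G - (overflow M + (real M)\<^sup>2 * ?w G) \<le> gain ?j G"
      by (intro gain_ge fin attach_prob_bound G) auto
    then show "((pref_rate * real (Suc i) + unif_rate) * tail_sum (Suc i) G
        - (pref_rate * real i + unif_rate) * tail_sum ?j G) / ?N - EA * rel_error t G
        - (overflow M + (real M)\<^sup>2 * ?w G) \<le> gain ?j G"
      using upper_weight_approx[OF G, of i] by linarith
  qed
  moreover have "measure_pmf.expectation (net t)
    (\<lambda>G. ((pref_rate * real (Suc i) + unif_rate) * tail_sum (Suc i) G
        - (pref_rate * real i + unif_rate) * tail_sum ?j G) / ?N - EA * rel_error t G
        - (overflow M + (real M)\<^sup>2 * ?w G))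
    = ((pref_rate * real (Suc i) + unif_rate) * mean_tail (Suc i) t
        - (pref_rate * real i + unif_rate) * mean_tail ?j t) / ?N - EA * degree_error t
        - (overflow M + (real M)\<^sup>2 * ((real J + mean_tail J t) / (m * ?N) + degree_error t + 1 / ?N))"
    by (simp add: mean_tail_def expectation_rel_error)
  ultimately show ?thesis
    unfolding mean_tail_Suc by (simp add: diff_divide_distrib)
qed

section \<open>The limit sequence and convergence of the averages\<close>

text \<open>The fixed point in the averaging lemmas: source divided by \<open>1 + \<gamma>\<close>.
  The start is the density of in-degrees plus one for each node, because \<open>tail_sum 0\<close>
  adds up \<open>Suc (deg G v)\<close>.\<close>

primrec limit_tail :: "nat \<Rightarrow> real" where
  "limit_tail 0 = m + 1"
| "limit_tail (Suc j) = ((pref_rate * real j + unif_rate) * limit_tail j + limit_source (Suc j))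
     / (1 + (pref_rate * (real j - 1) + unif_rate))"

lemmas [simp del] = limit_tail.simps(2)

lemma limit_tail_denom_pos: "0 < 1 + (pref_rate * (real j - 1) + unif_rate)"
proof -
  have "0 \<le> pref_rate * real j" using rates by simp
  moreover have "1 + (pref_rate * (real j - 1) + unif_rate) = 1 + pref_rate * real j - pref_rate + unif_rate"
    by (simp add: algebra_simps)
  ultimately show ?thesis using rates by linarith
qed

lemma limit_tail_nonneg: "0 \<le> limit_tail j"
proof (induction j)
  case (Suc j)
  then show ?case
    using rates limit_source_nonneg limit_tail_denom_pos[of j] unfolding limit_tail.simps
    by (auto intro!: divide_nonneg_pos add_nonneg_nonneg mult_nonneg_nonneg)
qed (use m_pos in simp)

text \<open>The inequalities of the network begin at index 2, but the recurrence also returns the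
  correct density \<open>m\<close> at index 1, since \<open>m * pref_rate = p * EA\<close>. So one
  recurrence covers all indices and can be differenced from the start.\<close>

lemma limit_tail_1: "limit_tail 1 = m"
proof -
  have "1 + q \<noteq> 0" using q by simp
  have "unif_rate * (m + 1) + q * EA = m * (1 + (pref_rate * (0 - 1) + unif_rate))"
    using \<open>1 + q \<noteq> 0\<close> by (simp add: unif_rate_def pref_rate_def m_def field_simps)
  then show ?thesis
    using limit_source_1 limit_tail_denom_pos[of 0]
    by (simp add: limit_tail.simps(2) nonzero_divide_eq_eq)
qed

lemma limit_tail_tendsto: "limit_tail \<longlonglongrightarrow> 0"
proof (rule tail_recursion_tendsto_0)
  show "limit_tail (Suc j) * (1 + pref_rate * (real j - 1) + unif_rate)
     = (pref_rate * real j + unif_rate) * limit_tail j + limit_source (Suc j)" for j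
    using limit_tail_denom_pos[of j] by (simp add: limit_tail.simps(2) add.assoc)
  show "(\<lambda>j. limit_source (Suc j)) \<longlonglongrightarrow> 0" using limit_source_tendsto by (rule LIMSEQ_Suc)
qed (use rates limit_tail_nonneg in auto)

lemma mean_tail_0: "mean_tail 0 t = mean_tail 1 t + real (num t)"
proof -
  have "mean_tail 0 t = measure_pmf.expectation (net t) (\<lambda>G. tail_sum 1 G + real (num t))"
    unfolding mean_tail_def
  proof (rule expectation_pmf_cong)
    fix G assume "G \<in> set_pmf (net t)"
    then have "card (pverts G) = num t" using network_support by auto
    then show "tail_sum 0 G = tail_sum 1 G + real (num t)"
      by (simp add: tail_sum_def sum.distrib)
  qed
  then show ?thesis by (simp add: mean_tail_def)
qed

text \<open>Induction on the index: the average at \<open>Suc i\<close> acts as a source term in the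
  recursion at \<open>Suc (Suc i)\<close>.\<close>

lemma mean_tail_le:
  assumes "0 < \<epsilon>"
  shows "eventually (\<lambda>t. mean_tail (Suc i) t / real (num t) \<le> limit_tail (Suc i) + \<epsilon>) sequentially"
  using assms
proof (induction i arbitrary: \<epsilon>)
  case 0
  have "eventually (\<lambda>t. mean_tail 1 t / real (num t) < m + \<epsilon>) sequentially"
    using mean_tail_1_tendsto 0 by (intro order_tendstoD(2)) auto
  then show ?case using limit_tail_1 by (auto elim: eventually_mono)
next
  case (Suc i)
  let ?j = "Suc (Suc i)"
  define \<kappa> where "\<kappa> = pref_rate * real (Suc i) + unif_rate"
  define \<gamma> where "\<gamma> = pref_rate * real i + unif_rate"
  have nonneg: "0 \<le> \<kappa>" "0 \<le> \<gamma>" using rates by (auto simp: \<kappa>_def \<gamma>_def)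
  have "eventually (\<lambda>t. mean_tail ?j t / real (card (pverts G\<^sub>0) + t)
     \<le> (\<kappa> * limit_tail (Suc i) + limit_source ?j) / (1 + \<gamma>) + \<epsilon>) sequentially"
  proof (rule average_le_of_recursion[OF nonneg(2) _ _ Suc.prems])
    show "mean_tail ?j (Suc t) \<le> mean_tail ?j t - \<gamma> * mean_tail ?j t / real (card (pverts G\<^sub>0) + t)
       + (\<kappa> * (mean_tail (Suc i) t / real (num t)) + (EA * degree_error t + source ?j t))" for t
      using mean_tail_Suc_le[of i t] unfolding \<kappa>_def \<gamma>_def num_def .
    fix e :: real assume e: "0 < e"
    have "(\<lambda>t. EA * degree_error t + source ?j t) \<longlonglongrightarrow> EA * 0 + limit_source ?j"
      by (intro tendsto_intros degree_error_tendsto source_tendsto)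
    then have "eventually (\<lambda>t. EA * degree_error t + source ?j t < limit_source ?j + e / 2) sequentially"
      using e by (intro order_tendstoD(2)) auto
    \<comment> \<open>Chosen so that multiplication by \<kappa> yields at most \<open>e / 2\<close>;
      the \<open>+ 1\<close> keeps the denominator positive.\<close>
    moreover have "0 < e / (2 * (\<kappa> + 1))" using e nonneg by simp
    note Suc.IH[OF this]
    ultimately show "eventually (\<lambda>t. \<kappa> * (mean_tail (Suc i) t / real (num t))
       + (EA * degree_error t + source ?j t) \<le> \<kappa> * limit_tail (Suc i) + limit_source ?j + e) sequentially"
    proof eventually_elim
      case (elim t)
      have "\<kappa> * (mean_tail (Suc i) t / real (num t)) \<le> \<kappa> * (limit_tail (Suc i) + e / (2 * (\<kappa> + 1)))"
        using elim(2) nonneg by (intro mult_left_mono) auto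
      also have "\<dots> \<le> \<kappa> * limit_tail (Suc i) + e / 2"
        using nonneg e by (simp add: field_simps)
      finally show ?case using elim(1) by linarith
    qed
  qed
  then show ?case by (simp add: limit_tail.simps(2)[of "Suc i"] num_def \<kappa>_def \<gamma>_def)
qed

text \<open>
  Drawing without replacement is noticeable only if some node carries a positive fraction of all
  edges, which the upper bound \<open>mean_tail_le\<close> excludes since \<open>limit_tail\<close> tends to 0.
\<close>
lemma loss_small:
  assumes "0 < \<epsilon>"
  obtains M J where "eventually (\<lambda>t. overflow M + (real M)\<^sup>2 *
      ((real J + mean_tail J t) / (m * real (num t)) + degree_error t + 1 / real (num t)) \<le> \<epsilon>) sequentially"
proof -
  have "eventually (\<lambda>M. overflow M < \<epsilon> / 2) sequentially"
    using overflow_tendsto assms by (intro order_tendstoD(2)) auto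
  then obtain M where M: "overflow M < \<epsilon> / 2" by (auto simp: eventually_sequentially)
  \<comment> \<open>Order of the choices: \<open>M\<close> controls the overflow, \<delta>
    compensates the factor \<open>(real M)\<^sup>2\<close>, then the index of the tail is chosen for
    \<delta>, and the time comes last.\<close>
  define \<delta> where "\<delta> = \<epsilon> / (4 * ((real M)\<^sup>2 + 1))"
  have "0 < (real M)\<^sup>2 + 1" by (simp add: add_nonneg_pos)
  then have \<delta>: "0 < \<delta>" "(real M)\<^sup>2 * (2 * \<delta>) \<le> \<epsilon> / 2"
    using assms by (auto simp: \<delta>_def field_simps)
  have "(\<lambda>i. limit_tail (Suc i)) \<longlonglongrightarrow> 0" using limit_tail_tendsto by (rule LIMSEQ_Suc)
  then have "eventually (\<lambda>i. limit_tail (Suc i) < m * \<delta> / 2) sequentially"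
    using m_pos \<delta> by (intro order_tendstoD(2)) auto
  then obtain i where i: "limit_tail (Suc i) < m * \<delta> / 2" by (auto simp: eventually_sequentially)
  let ?J = "Suc i"
  have "0 < m * \<delta> / 2" using m_pos \<delta> by simp
  then have ev: "eventually (\<lambda>t. mean_tail ?J t / real (num t) \<le> limit_tail ?J + m * \<delta> / 2) sequentially"
    by (rule mean_tail_le)
  have "(\<lambda>t. real ?J / m * (1 / real (num t)) + degree_error t + 1 / real (num t))
      \<longlonglongrightarrow> real ?J / m * 0 + 0 + 0"
  proof (intro tendsto_intros degree_error_tendsto)
    show "(\<lambda>t. 1 / real (num t)) \<longlonglongrightarrow> 0" unfolding num_def by real_asymp
    show "(\<lambda>t. 1 / real (num t)) \<longlonglongrightarrow> 0" unfolding num_def by real_asymp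
  qed
  then have "eventually (\<lambda>t. real ?J / m * (1 / real (num t)) + degree_error t + 1 / real (num t) < \<delta>) sequentially"
    using \<delta> by (intro order_tendstoD(2)) auto
  with ev have "eventually (\<lambda>t. overflow M + (real M)\<^sup>2 *
      ((real ?J + mean_tail ?J t) / (m * real (num t)) + degree_error t + 1 / real (num t)) \<le> \<epsilon>) sequentially"
  proof eventually_elim
    case (elim t)
    have "mean_tail ?J t / real (num t) / m \<le> \<delta>"
    proof -
      have "mean_tail ?J t / real (num t) \<le> m * \<delta>" using elim(1) i by linarith
      then show ?thesis using m_pos by (simp only: pos_divide_le_eq mult.commute)
    qed
    then have "(real ?J + mean_tail ?J t) / (m * real (num t)) + degree_error t + 1 / real (num t) \<le> 2 * \<delta>"
      using elim(2) by (simp add: add_divide_distrib mult.commute)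
    then have "(real M)\<^sup>2 * ((real ?J + mean_tail ?J t) / (m * real (num t)) + degree_error t + 1 / real (num t))
       \<le> (real M)\<^sup>2 * (2 * \<delta>)" by (intro mult_left_mono) auto
    then show ?case using M \<delta>(2) by linarith
  qed
  then show ?thesis by (rule that)
qed

lemma mean_tail_ge:
  assumes "0 < \<epsilon>"
  shows "eventually (\<lambda>t. mean_tail (Suc i) t / real (num t) \<ge> limit_tail (Suc i) - \<epsilon>) sequentially"
  using assms
proof (induction i arbitrary: \<epsilon>)
  case 0
  have "eventually (\<lambda>t. mean_tail 1 t / real (num t) > m - \<epsilon>) sequentially"
    using mean_tail_1_tendsto 0 by (intro order_tendstoD(1)) auto
  then show ?case using limit_tail_1 by (auto elim: eventually_mono)
next
  case (Suc i)
  let ?j = "Suc (Suc i)"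
  define \<kappa> where "\<kappa> = pref_rate * real (Suc i) + unif_rate"
  define \<gamma> where "\<gamma> = pref_rate * real i + unif_rate"
  have nonneg: "0 \<le> \<kappa>" "0 \<le> \<gamma>" using rates by (auto simp: \<kappa>_def \<gamma>_def)
  \<comment> \<open>The exact remainder, so the recursion holds trivially and only the lower limit
    of \<open>g\<close> is at stake. This allows \<open>M\<close> and \<open>J\<close> to depend on
    the accuracy \<open>e\<close>, which a remainder built from \<open>mean_tail_Suc_ge\<close> with
    fixed \<open>M\<close> and \<open>J\<close> would not.\<close>
  define g where "g t = mean_tail ?j (Suc t) - mean_tail ?j t
     + \<gamma> * mean_tail ?j t / real (card (pverts G\<^sub>0) + t)" for t
  have "eventually (\<lambda>t. mean_tail ?j t / real (card (pverts G\<^sub>0) + t)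
     \<ge> (\<kappa> * limit_tail (Suc i) + limit_source ?j) / (1 + \<gamma>) - \<epsilon>) sequentially"
  proof (rule average_ge_of_recursion[OF nonneg(2) _ _ Suc.prems])
    show "mean_tail ?j (Suc t) \<ge> mean_tail ?j t - \<gamma> * mean_tail ?j t / real (card (pverts G\<^sub>0) + t) + g t" for t
      by (simp add: g_def)
    fix e :: real assume e: "0 < e"
    have "0 < e / 3" using e by simp
    then obtain M J where loss: "eventually (\<lambda>t. overflow M + (real M)\<^sup>2 *
      ((real J + mean_tail J t) / (m * real (num t)) + degree_error t + 1 / real (num t)) \<le> e / 3) sequentially"
      by (rule loss_small)
    have "(\<lambda>t. source ?j t - EA * degree_error t) \<longlonglongrightarrow> limit_source ?j - EA * 0"
      by (intro tendsto_intros degree_error_tendsto source_tendsto)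
    then have "eventually (\<lambda>t. limit_source ?j - e / 3 < source ?j t - EA * degree_error t) sequentially"
      using e by (intro order_tendstoD(1)) auto
    moreover have "0 < e / (3 * (\<kappa> + 1))" using e nonneg by simp
    note Suc.IH[OF this]
    ultimately show "eventually (\<lambda>t. g t \<ge> \<kappa> * limit_tail (Suc i) + limit_source ?j - e) sequentially"
      using loss
    proof eventually_elim
      case (elim t)
      have "\<kappa> * limit_tail (Suc i) - e / 3 \<le> \<kappa> * (limit_tail (Suc i) - e / (3 * (\<kappa> + 1)))"
        using nonneg e by (simp add: field_simps)
      also have "\<dots> \<le> \<kappa> * (mean_tail (Suc i) t / real (num t))"
        using elim(2) nonneg by (intro mult_left_mono) auto
      finally show ?case
        using elim(1,3) mean_tail_Suc_ge[of i t M J]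
        unfolding g_def \<kappa>_def[symmetric] \<gamma>_def[symmetric] num_def[symmetric] by linarith
    qed
  qed
  then show ?case by (simp add: limit_tail.simps(2)[of "Suc i"] num_def \<kappa>_def \<gamma>_def)
qed

lemma mean_tail_tendsto: "(\<lambda>t. mean_tail j t / real (num t)) \<longlonglongrightarrow> limit_tail j"
proof (cases j)
  case 0
  have "(\<lambda>t. mean_tail 1 t / real (num t) + 1) \<longlonglongrightarrow> m + 1"
    by (intro tendsto_intros mean_tail_1_tendsto)
  moreover have "mean_tail 0 t / real (num t) = mean_tail 1 t / real (num t) + 1" for t
    using num_pos[of t] by (simp add: mean_tail_0 add_divide_distrib)
  ultimately show ?thesis using 0 by simp
next
  case (Suc i)
  show ?thesis unfolding Suc
  proof (rule order_tendstoI)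
    fix u assume "limit_tail (Suc i) < u"
    then have "0 < (u - limit_tail (Suc i)) / 2" by simp
    from mean_tail_le[OF this, of i]
    show "eventually (\<lambda>t. mean_tail (Suc i) t / real (num t) < u) sequentially"
    proof eventually_elim
      case (elim t)
      then show ?case using \<open>limit_tail (Suc i) < u\<close> by (simp add: field_simps)
    qed
  next
    fix u assume "u < limit_tail (Suc i)"
    then have "0 < (limit_tail (Suc i) - u) / 2" by simp
    from mean_tail_ge[OF this, of i]
    show "eventually (\<lambda>t. u < mean_tail (Suc i) t / real (num t)) sequentially"
    proof eventually_elim
      case (elim t)
      then show ?case using \<open>u < limit_tail (Suc i)\<close> by (simp add: field_simps)
    qed
  qed
qed

end

section \<open>The limiting degree distribution\<close>

text \<open>Second differences of hinge functions are point masses. It is applied both to the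
  in-degrees of a network and to the binomial in-degree of the new node.\<close>

lemma nat_diff_second_difference:
  "real (Suc d - k) - 2 * real (Suc d - Suc k) + real (Suc d - Suc (Suc k)) = (if d = k then 1 else 0)"
proof (cases "d \<le> k")
  case False
  then have "real (Suc d - k) = real d - real k + 1" "real (Suc d - Suc k) = real d - real k"
    "real (Suc d - Suc (Suc k)) = real d - real k - 1" by linarith+
  then show ?thesis using False by simp
qed (auto simp: Suc_diff_le)

lemma card_degree_eq:
  assumes "finite (pverts G)"
  shows "real (card (pverts G \<inter> deg G -` {k}))
     = tail_sum k G - 2 * tail_sum (Suc k) G + tail_sum (Suc (Suc k)) G"
proof -
  have "real (card (pverts G \<inter> deg G -` {k})) = (\<Sum>v\<in>pverts G. if deg G v = k then 1 else 0)"
    using assms by (subst sum.If_cases) (auto intro!: arg_cong[where f = card])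
  then show ?thesis
    by (simp only: tail_sum_def nat_diff_second_difference[symmetric] sum.distrib sum_subtractf sum_distrib_left)
qed

lemma binomial_tail_second_difference:
  assumes "0 \<le> q" "q \<le> 1"
  shows "binomial_tail q k n - 2 * binomial_tail q (Suc k) n + binomial_tail q (Suc (Suc k)) n
     = pmf (binomial_pmf n q) k"
proof -
  have int: "integrable (measure_pmf (binomial_pmf n q)) f" for f :: "nat \<Rightarrow> real"
    using assms by (intro integrable_binomial_pmf) auto
  have "binomial_tail q k n - 2 * binomial_tail q (Suc k) n + binomial_tail q (Suc (Suc k)) n
    = measure_pmf.expectation (binomial_pmf n q)
       (\<lambda>d. real (Suc d - k) - 2 * real (Suc d - Suc k) + real (Suc d - Suc (Suc k)))"
    by (simp add: binomial_tail_def int)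
  also have "\<dots> = pmf (binomial_pmf n q) k"
    unfolding nat_diff_second_difference by (subst integral_measure_pmf_real[of "{k}"]) (auto split: if_splits)
  finally show ?thesis .
qed

lemma expectation_pmf_binomial:
  assumes "0 < q" "q \<le> 1"
  shows "measure_pmf.expectation A (\<lambda>a. pmf (binomial_pmf a q) k) = new_degree_prob q A k"
proof (cases "q = 1")
  case True
  then have "measure_pmf.expectation A (\<lambda>a. pmf (binomial_pmf a q) k)
     = measure_pmf.expectation A (\<lambda>a. if a = k then 1 else 0)"
    by (intro expectation_pmf_cong) (auto simp: binomial_eq_0_iff)
  also have "\<dots> = pmf A k" by (subst integral_measure_pmf_real[of "{k}"]) (auto split: if_splits)
  finally show ?thesis using True by (simp add: new_degree_prob_def)
next
  case False
  let ?f = "\<lambda>a. pmf A a * pmf (binomial_pmf a q) k"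
  \<comment> \<open>Domination by \<open>pmf A\<close> permits the passage from the expectation to
    the unconditional sum \<open>infsum\<close>.\<close>
  have "Infinite_Set_Sum.abs_summable_on ?f UNIV"
    using pmf_abs_summable[of A UNIV]
    by (rule abs_summable_on_comparison_test) (simp add: pmf_le_1 mult_left_le)
  then have "measure_pmf.expectation A (\<lambda>a. pmf (binomial_pmf a q) k) = (\<Sum>\<^sub>\<infinity>a\<in>UNIV. ?f a)"
    by (simp only: pmf_expectation_eq_infsetsum infsetsum_infsum)
  also have "\<dots> = (\<Sum>\<^sub>\<infinity>a\<in>{k..}. real (a choose k) * q ^ k * (1 - q) ^ (a - k) * pmf A a)"
    using assms by (intro infsum_cong_neutral) (auto simp: binomial_eq_0)
  finally show ?thesis using False by (simp add: new_degree_prob_def)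
qed

context mixed_attachment
begin

text \<open>The number of nodes at time \<open>t\<close> is deterministic, so the denominator of the
  uniform choice leaves the expectation.\<close>

lemma pmf_degree:
  "pmf (degree_pmf p q A G\<^sub>0 t) k
     = (mean_tail k t - 2 * mean_tail (Suc k) t + mean_tail (Suc (Suc k)) t) / real (num t)"
proof -
  have "pmf (degree_pmf p q A G\<^sub>0 t) k
    = measure_pmf.expectation (net t) (\<lambda>G. pmf (map_pmf (deg G) (pmf_of_set (pverts G))) k)"
    by (simp add: degree_pmf_def pmf_bind)
  also have "\<dots> = measure_pmf.expectation (net t)
     (\<lambda>G. (tail_sum k G - 2 * tail_sum (Suc k) G + tail_sum (Suc (Suc k)) G) / real (num t))"
  proof (rule expectation_pmf_cong)
    fix G assume "G \<in> set_pmf (net t)"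
    then have G: "pair_fin_digraph G" "card (pverts G) = num t" using network_support by auto
    have fin: "finite (pverts G)" using G(1) by (rule pair_fin_digraph.pair_finite_verts)
    have "pverts G \<noteq> {}" using G(2) num_pos[of t] by auto
    then show "pmf (map_pmf (deg G) (pmf_of_set (pverts G))) k
      = (tail_sum k G - 2 * tail_sum (Suc k) G + tail_sum (Suc (Suc k)) G) / real (num t)"
      using fin by (simp add: pmf_map measure_pmf_of_set card_degree_eq G(2))
  qed
  also have "\<dots> = (mean_tail k t - 2 * mean_tail (Suc k) t + mean_tail (Suc (Suc k)) t) / real (num t)"
    by (simp add: mean_tail_def)
  finally show ?thesis .
qed

definition limit_prob :: "nat \<Rightarrow> real" where
  "limit_prob k = limit_tail k - 2 * limit_tail (Suc k) + limit_tail (Suc (Suc k))"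

lemma pmf_degree_tendsto: "(\<lambda>t. pmf (degree_pmf p q A G\<^sub>0 t) k) \<longlonglongrightarrow> limit_prob k"
proof -
  have "(\<lambda>t. mean_tail k t / real (num t) - 2 * (mean_tail (Suc k) t / real (num t))
     + mean_tail (Suc (Suc k)) t / real (num t)) \<longlonglongrightarrow> limit_prob k"
    unfolding limit_prob_def by (intro tendsto_intros mean_tail_tendsto)
  then show ?thesis by (simp add: pmf_degree add_divide_distrib diff_divide_distrib)
qed

lemma limit_source_second_difference:
  "limit_source k - 2 * limit_source (Suc k) + limit_source (Suc (Suc k)) = new_degree_prob q A k"
proof -
  have "limit_source k - 2 * limit_source (Suc k) + limit_source (Suc (Suc k))
    = measure_pmf.expectation A (\<lambda>a. binomial_tail q k a - 2 * binomial_tail q (Suc k) a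
        + binomial_tail q (Suc (Suc k)) a)"
    by (simp add: limit_source_def integrable_binomial_tail)
  then show ?thesis
    by (simp only: binomial_tail_second_difference[OF q_nonneg q(2)] expectation_pmf_binomial[OF q])
qed

lemma limit_tail_recurrence:
  "limit_tail (Suc j) * (1 + (pref_rate * (real j - 1) + unif_rate))
     = (pref_rate * real j + unif_rate) * limit_tail j + limit_source (Suc j)"
  using limit_tail_denom_pos[of j] by (simp add: limit_tail.simps(2))

text \<open>Combine three consecutive recurrences with weights 1, -2, 1. Their coefficients are
  linear in the index, and moving them to the coefficients of the claim adds \<open>2 * pref_rate *
  (limit_tail (Suc k) - limit_tail (Suc (Suc k)))\<close> on both sides.\<close>

lemma limit_prob_Suc:
  "limit_prob (Suc k) * (1 + (pref_rate * real (Suc k) + unif_rate))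
     = (pref_rate * real k + unif_rate) * limit_prob k + new_degree_prob q A (Suc k)"
  unfolding limit_prob_def limit_source_second_difference[of "Suc k", symmetric]
  using limit_tail_recurrence[of k] limit_tail_recurrence[of "Suc k"]
    limit_tail_recurrence[of "Suc (Suc k)"]
  by (simp add: algebra_simps)

text \<open>Of the three recurrences to be combined the lowest would have index -1; explicit values
  of \<open>limit_tail\<close> and \<open>limit_source\<close> at 0 and 1 take its place.\<close>

lemma limit_prob_0: "limit_prob 0 * (1 + unif_rate) = new_degree_prob q A 0"
proof -
  have src: "limit_source 0 = 1 + q * EA"
  proof -
    have "limit_source 0 = measure_pmf.expectation A (\<lambda>a. 1 + q * real a)"
      unfolding limit_source_def binomial_tail_def
      using q_nonneg q(2) by (simp add: integrable_binomial expectation_binomial_real mult.commute)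
    then show ?thesis using integrable_A by (simp add: EA_def)
  qed
  have m: "pref_rate * m + unif_rate = m - q * EA"
  proof -
    have "1 + q \<noteq> 0" using q by simp
    then show ?thesis by (simp add: pref_rate_def unif_rate_def m_def field_simps)
  qed
  have l1: "limit_tail (Suc 0) = m" using limit_tail_1 by simp
  have "limit_tail (Suc (Suc 0)) * (1 + unif_rate) = (pref_rate + unif_rate) * m + limit_source (Suc (Suc 0))"
    using limit_tail_recurrence[of "Suc 0"] l1 by simp
  then show ?thesis
    unfolding limit_prob_def limit_source_second_difference[of 0, symmetric]
    using src limit_source_1 m l1 by (simp add: algebra_simps)
qed

end

section \<open>Solving the recurrence\<close>

text \<open>Variation of constants: the Gamma quotient solves the homogeneous recurrence by
  \<open>Gamma_plus1\<close>, and positive \<open>a\<close> and \<open>b\<close> stay away from the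
  poles.\<close>

lemma recurrence_solution_Gamma:
  fixes x y :: "nat \<Rightarrow> real"
  assumes a: "0 < a" and b: "0 < b"
    and x0: "x 0 = y 0" and rec: "\<And>k. x (Suc k) = (real k + a) / (real k + b) * x k + y (Suc k)"
  shows "x k = Gamma (real k + a) / Gamma (real k + b) *
    (\<Sum>j=0..k. Gamma (real j + b) / Gamma (real j + a) * y j)"
proof (induction k)
  case 0
  have "Gamma a \<noteq> 0" "Gamma b \<noteq> 0"
    using Gamma_real_pos[OF a] Gamma_real_pos[OF b] by auto
  then show ?case by (simp add: x0)
next
  case (Suc k)
  have pos: "0 < real k + a" "0 < real k + b" using a b by auto
  have Gam: "Gamma (real (Suc k) + a) = (real k + a) * Gamma (real k + a)"
    "Gamma (real (Suc k) + b) = (real k + b) * Gamma (real k + b)"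
    using Gamma_plus1[of "real k + a"] Gamma_plus1[of "real k + b"] pos
    by (auto simp: add_ac nonpos_Ints_def)
  have "0 < real (Suc k) + a" "0 < real (Suc k) + b" using a b by auto
  from this[THEN Gamma_real_pos]
  have nz: "Gamma (real (Suc k) + a) \<noteq> 0" "Gamma (real (Suc k) + b) \<noteq> 0" by linarith+
  define S where "S = (\<Sum>j=0..k. Gamma (real j + b) / Gamma (real j + a) * y j)"
  have "Gamma (real (Suc k) + a) / Gamma (real (Suc k) + b)
      * (\<Sum>j=0..Suc k. Gamma (real j + b) / Gamma (real j + a) * y j)
    = Gamma (real (Suc k) + a) / Gamma (real (Suc k) + b) * S + y (Suc k)"
    using nz by (simp add: S_def distrib_left del: of_nat_Suc)
  also have "Gamma (real (Suc k) + a) / Gamma (real (Suc k) + b) * S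
     = (real k + a) / (real k + b) * (Gamma (real k + a) / Gamma (real k + b) * S)"
    unfolding Gam by simp
  also have "Gamma (real k + a) / Gamma (real k + b) * S = x k"
    using Suc by (simp add: S_def)
  finally show ?case by (simp add: rec)
qed

lemma recurrence_solution_geometric:
  fixes x y :: "nat \<Rightarrow> real"
  assumes "x 0 = y 0" "\<And>k. x (Suc k) = c * x k + y (Suc k)"
  shows "x k = (\<Sum>j=0..k. c ^ (k - j) * y j)"
proof (induction k)
  case (Suc k)
  have "(\<Sum>j=0..k. c ^ (Suc k - j) * y j) = c * (\<Sum>j=0..k. c ^ (k - j) * y j)"
    unfolding sum_distrib_left by (intro sum.cong) (auto simp: Suc_diff_le)
  then show ?case using Suc assms by simp
qed (use assms in simp)

theorem mainTheorem3:
  fixes p q EA m :: real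
    and A :: "nat pmf"
    and G\<^sub>0 :: "nat pair_pre_digraph"
    and P B :: "nat \<Rightarrow> real"
  assumes seed: "pair_fin_digraph G\<^sub>0" "pverts G\<^sub>0 \<noteq> {}"
    and p: "0 \<le> p" "p \<le> 1"
    and q: "0 < q" "q \<le> 1"
    and A: "integrable (measure_pmf A) real" "0 < measure_pmf.expectation A real"
  defines "EA \<equiv> measure_pmf.expectation A real"
    and "m \<equiv> (1 + q) * EA"
    and "B \<equiv> new_degree_prob q A"
    and "P \<equiv> (\<lambda>k. lim (\<lambda>t. pmf (degree_pmf p q A G\<^sub>0 t) k))"
  shows
    "(\<forall>k. convergent (\<lambda>t. pmf (degree_pmf p q A G\<^sub>0 t) k)) \<and>
     P 0 = B 0 / (1 + EA * (1 - p)) \<and>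
     (\<forall>k>0. P k =
        (p * (real k - 1) + m * (1 - p)) / (1 + q + p * real k + m * (1 - p)) * P (k - 1)
        + (1 + q) * B k / (1 + q + p * real k + m * (1 - p))) \<and>
     (p = 0 \<longrightarrow>
        (\<forall>k. P k = 1 / (1 + EA) * (\<Sum>j=0..k. (EA / (1 + EA)) ^ (k - j) * B j))) \<and>
     (0 < p \<and> p < 1 \<longrightarrow>
        (\<forall>k. P k =
           Gamma (real k + m * (1 - p) / p) / Gamma (real k + (1 + q + p + m * (1 - p)) / p) *
           (\<Sum>j=0..k.
              (1 + q) * Gamma (real j + (1 + q + p + m * (1 - p)) / p) /
              (((1 + q) * (1 + EA * (1 - p)) + p * real j) * Gamma (real j + m * (1 - p) / p))
              * B j))) \<and>
     (p = 1 \<longrightarrow>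
        P 0 = B 0 \<and>
        (\<forall>k>0. P k =
           (1 + q) * Gamma (real k) / Gamma (real k + q + 2) *
           (\<Sum>j=1..k. Gamma (real j + q + 2) / ((real j + q + 1) * Gamma (real j)) * B j)))"
  proof -
  interpret M: mixed_attachment p q A G\<^sub>0
    by (intro mixed_attachment.intro seed p q A)
  have M_eq: "M.EA = EA" "M.m = m"
    by (simp_all add: EA_def m_def M.EA_def M.m_def)
  have EA: "0 < EA" and m: "0 < m"
    using M.EA_pos M.m_pos by (simp_all only: M_eq)
  have P: "P k = M.limit_prob k" for k
    unfolding P_def by (rule limI) (rule M.pmf_degree_tendsto)
  have conv: "\<forall>k. convergent (\<lambda>t. pmf (degree_pmf p q A G\<^sub>0 t) k)"
    using M.pmf_degree_tendsto by (auto simp: convergent_def)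
  \<comment> \<open>The denominator of the recurrence after multiplication by \<open>1 + q\<close>,
    which clears the fraction in \<open>pref_rate\<close>.\<close>
  define D where "D k = 1 + q + p * real k + m * (1 - p)" for k
  have D_pos: "0 < D k" for k
    unfolding D_def using p q m by (intro add_pos_nonneg) auto
  have D_0: "D 0 = (1 + q) * (1 + EA * (1 - p))"
    by (simp add: D_def m_def algebra_simps)
  have rate: "(1 + q) * (M.pref_rate * real k + M.unif_rate) = p * real k + m * (1 - p)" for k
  proof -
    have "1 + q \<noteq> 0" using q by simp
    then have "(1 + q) * M.pref_rate = p" by (simp add: M.pref_rate_def)
    then have "(1 + q) * (M.pref_rate * real k) = p * real k" by (metis mult.assoc)
    moreover have "(1 + q) * M.unif_rate = m * (1 - p)"
      by (simp add: M.unif_rate_def M_eq(1) m_def)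
    ultimately show ?thesis by (simp only: distrib_left)
  qed
  have P_0: "P 0 = B 0 / (1 + EA * (1 - p))"
  proof -
    have "P 0 * (1 + EA * (1 - p)) = B 0"
      using M.limit_prob_0 by (simp add: P B_def M.unif_rate_def M_eq(1) mult.commute)
    moreover have "0 < 1 + EA * (1 - p)" using EA p by (intro add_pos_nonneg) auto
    ultimately show ?thesis by (simp add: eq_divide_eq)
  qed
  \<comment> \<open>Gives the initial value the form of the inhomogeneous term, so that one formula
    covers \<open>j = 0\<close> as well.\<close>
  have P_0_D: "P 0 = (1 + q) * B 0 / D 0"
    using q by (simp add: P_0 D_0)
  have P_Suc: "P (Suc k) = (p * real k + m * (1 - p)) / D (Suc k) * P k + (1 + q) * B (Suc k) / D (Suc k)" for k
  proof -
    have "D (Suc k) = (1 + q) * (1 + (M.pref_rate * real (Suc k) + M.unif_rate))"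
      unfolding distrib_left[of "1 + q" 1] rate by (simp add: D_def)
    then have "P (Suc k) * D (Suc k) = (1 + q) * (P (Suc k) * (1 + (M.pref_rate * real (Suc k) + M.unif_rate)))"
      by (simp only: mult.left_commute)
    also have "\<dots> = ((1 + q) * (M.pref_rate * real k + M.unif_rate)) * P k + (1 + q) * B (Suc k)"
      unfolding P M.limit_prob_Suc by (simp add: B_def algebra_simps)
    finally have "P (Suc k) * D (Suc k) = (p * real k + m * (1 - p)) * P k + (1 + q) * B (Suc k)"
      unfolding rate .
    then have "P (Suc k) = ((p * real k + m * (1 - p)) * P k + (1 + q) * B (Suc k)) / D (Suc k)"
      using D_pos[of "Suc k"] by (simp add: eq_divide_eq)
    then show ?thesis
      by (simp only: add_divide_distrib[of "_ * P k"] times_divide_eq_left)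
  qed
  have P_rec: "\<forall>k>0. P k =
        (p * (real k - 1) + m * (1 - p)) / (1 + q + p * real k + m * (1 - p)) * P (k - 1)
        + (1 + q) * B k / (1 + q + p * real k + m * (1 - p))"
  proof (intro allI impI)
    fix k :: nat assume "0 < k"
    then obtain i where "k = Suc i" by (auto simp: gr0_conv_Suc)
    then show "P k = (p * (real k - 1) + m * (1 - p)) / (1 + q + p * real k + m * (1 - p)) * P (k - 1)
        + (1 + q) * B k / (1 + q + p * real k + m * (1 - p))"
      using P_Suc[of i] by (simp add: D_def)
  qed
  have case_0: "P k = 1 / (1 + EA) * (\<Sum>j=0..k. (EA / (1 + EA)) ^ (k - j) * B j)" if "p = 0" for k
  proof -
    have D: "D i = (1 + q) * (1 + EA)" for i using that by (simp add: D_def m_def algebra_simps)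
    have "1 + q \<noteq> 0" using q by simp
    have "P k = (\<Sum>j=0..k. (EA / (1 + EA)) ^ (k - j) * (B j / (1 + EA)))"
    proof (rule recurrence_solution_geometric[where x = P and y = "\<lambda>j. B j / (1 + EA)"])
      show "P 0 = B 0 / (1 + EA)" using that by (simp add: P_0)
      show "P (Suc i) = EA / (1 + EA) * P i + B (Suc i) / (1 + EA)" for i
        using P_Suc[of i] \<open>1 + q \<noteq> 0\<close> that by (simp add: D m_def)
    qed
    then show ?thesis by (simp add: sum_distrib_left)
  qed
  have case_between: "P k = Gamma (real k + m * (1 - p) / p) / Gamma (real k + (1 + q + p + m * (1 - p)) / p) *
           (\<Sum>j=0..k. (1 + q) * Gamma (real j + (1 + q + p + m * (1 - p)) / p) /
              (((1 + q) * (1 + EA * (1 - p)) + p * real j) * Gamma (real j + m * (1 - p) / p)) * B j)"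
    if p01: "0 < p" "p < 1" for k
  proof -
    let ?a = "m * (1 - p) / p" and ?b = "(1 + q + p + m * (1 - p)) / p"
    have pos: "0 < ?a" "0 < ?b" using p01 m q by (auto intro!: divide_pos_pos add_pos_pos mult_pos_pos)
    have "P k = Gamma (real k + ?a) / Gamma (real k + ?b) *
      (\<Sum>j=0..k. Gamma (real j + ?b) / Gamma (real j + ?a) * ((1 + q) * B j / D j))"
    proof (rule recurrence_solution_Gamma[where x = P and y = "\<lambda>j. (1 + q) * B j / D j", OF pos P_0_D])
      fix i
      \<comment> \<open>Numerator and denominator of the recurrence divided by \<open>p\<close>; the
        summand \<open>p\<close> inside \<open>?b\<close> is the shift from \<open>i\<close> to
        \<open>Suc i\<close> in \<open>D\<close>.\<close>
      have "real i + ?a = (p * real i + m * (1 - p)) / p" "real i + ?b = D (Suc i) / p"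
        using p01 by (simp_all add: D_def field_simps)
      then have "(real i + ?a) / (real i + ?b) = (p * real i + m * (1 - p)) / D (Suc i)"
        using p01 by simp
      then show "P (Suc i) = (real i + ?a) / (real i + ?b) * P i + (1 + q) * B (Suc i) / D (Suc i)"
        by (simp only: P_Suc)
    qed
    moreover have "D j = (1 + q) * (1 + EA * (1 - p)) + p * real j" for j
      using D_0 by (simp add: D_def)
    ultimately show ?thesis by (simp add: mult_ac)
  qed
  have case_1: "P k = (1 + q) * Gamma (real k) / Gamma (real k + q + 2) *
           (\<Sum>j=1..k. Gamma (real j + q + 2) / ((real j + q + 1) * Gamma (real j)) * B j)"
    if "p = 1" "0 < k" for k
  proof -
    obtain i where k: "k = Suc i" using \<open>0 < k\<close> by (auto simp: gr0_conv_Suc)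
    have D: "D j = real j + q + 1" for j using \<open>p = 1\<close> by (simp add: D_def)
    \<comment> \<open>For \<open>p = 1\<close> the parameter \<open>m * (1 - p) / p\<close> would be
      0, a pole of Gamma at index 0. The coefficient of \<open>P 0\<close> vanishes too, so the
      recurrence restarts at index 1 with parameters 1 and \<open>q + 3\<close>.\<close>
    have "P (Suc i) = Gamma (real i + 1) / Gamma (real i + (q + 3)) *
      (\<Sum>j=0..i. Gamma (real j + (q + 3)) / Gamma (real j + 1) * ((1 + q) * B (Suc j) / D (Suc j)))"
    proof (rule recurrence_solution_Gamma[where x = "\<lambda>i. P (Suc i)"
          and y = "\<lambda>j. (1 + q) * B (Suc j) / D (Suc j)"])
      show "P (Suc 0) = (1 + q) * B (Suc 0) / D (Suc 0)"
        using P_Suc[of 0] \<open>p = 1\<close> by simp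
      show "P (Suc (Suc j)) = (real j + 1) / (real j + (q + 3)) * P (Suc j)
          + (1 + q) * B (Suc (Suc j)) / D (Suc (Suc j))" for j
        using P_Suc[of "Suc j"] \<open>p = 1\<close> by (simp add: D add_ac)
    qed (use q in auto)
    then show ?thesis
      unfolding k One_nat_def sum.shift_bounds_cl_Suc_ivl
      by (simp add: D add_ac sum_distrib_left mult_ac)
  qed
  show ?thesis
    using conv P_0 P_rec case_0 case_between case_1 by simp
qed

end
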